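(* Let $c>0$ be fixed. For each $n$, let $(\sigma_t)_{t\ge0}$ be the interchange process on the complete graph $K_n$ started from the identity, let $t=c/n$, and let $d(t)$ be the minimal number of transpositions needed to write $\sigma_t$ as a product of transpositions. Then, as $n\to\infty$, $$\frac1n\,\mathbb{E}(d(t))\ \to\ u(c):=1-\sum_{k=1}^\infty\frac{k^{k-2}}{k!}\,\frac1c\,(ce^{-c})^k.$$
   Context: The interchange process on $K_n$ is the continuous-time random walk $(\sigma_t)_{t\ge0}$ on the symmetric group $S_n$, with $\sigma_0=\mathrm{id}$, in which each of the $\binom n2$ transpositions $(i,j)$, $1\le i<j\le n$, is applied (multiplied to the current permutation) at rate $1$, independently. Equivalently, its generator, viewed as an element of the group algebra $\mathbb{C}[S_n]$, is $Q=\sum_{i<j}[(i,j)-\mathrm{id}]$, and $\mathbb{P}(\sigma_t=s)$ is the coefficient of $s$ in $e^{tQ}$. *)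

theory Defs
  imports "HOL-Probability.Probability" "HOL-Combinatorics.Permutations"
begin

definition sym_grp :: "nat \<Rightarrow> (nat \<Rightarrow> nat) set" where
  "sym_grp n = {p. p permutes {1..n}}"

definition transpositions :: "nat \<Rightarrow> (nat \<Rightarrow> nat) set" where
  "transpositions n = {Transposition.transpose i j | i j. 1 \<le> i \<and> i < j \<and> j \<le> n}"

definition transposition_length :: "nat \<Rightarrow> (nat \<Rightarrow> nat) \<Rightarrow> nat" where
  "transposition_length n p =
     (LEAST k. \<exists>ts. length ts = k \<and> set ts \<subseteq> transpositions n \<and> p = foldr (\<circ>) ts id)"

text \<open>
  Elements of the group algebra of the symmetric group on \<open>{1..n}\<close> are represented by their
  coefficient functions, which vanish outside \<open>sym_grp n\<close>.
\<close>

type_synonym galg = "(nat \<Rightarrow> nat) \<Rightarrow> complex"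

definition galg_basis :: "(nat \<Rightarrow> nat) \<Rightarrow> galg" where
  "galg_basis p = (\<lambda>s. if s = p then 1 else 0)"

definition galg_mult :: "nat \<Rightarrow> galg \<Rightarrow> galg \<Rightarrow> galg" where
  "galg_mult n f g =
     (\<lambda>s. \<Sum>u\<in>sym_grp n. \<Sum>v\<in>sym_grp n. if u \<circ> v = s then f u * g v else 0)"

definition galg_power :: "nat \<Rightarrow> galg \<Rightarrow> nat \<Rightarrow> galg" where
  "galg_power n f k = (galg_mult n f ^^ k) (galg_basis id)"

text \<open>
  The exponential series, summed coefficientwise. The algebra is finite-dimensional, so this is
  convergence in the algebra; see \<open>galg_exp_summable\<close> below.
\<close>

definition galg_exp :: "nat \<Rightarrow> galg \<Rightarrow> galg" where
  "galg_exp n f = (\<lambda>s. \<Sum>k. galg_power n f k s / fact k)"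

definition interchange_generator :: "nat \<Rightarrow> galg" where
  "interchange_generator n =
     (\<lambda>s. \<Sum>(i, j) | 1 \<le> i \<and> i < j \<and> j \<le> n. galg_basis (Transposition.transpose i j) s - galg_basis id s)"

definition interchange_semigroup :: "nat \<Rightarrow> real \<Rightarrow> galg" where
  "interchange_semigroup n t =
     galg_exp n (\<lambda>s. complex_of_real t * interchange_generator n s)"

text \<open>
  The continuous-time random walk with generator \<open>interchange_generator n\<close>: a right-continuous
  Markov chain started at the identity, whose increment \<open>inv (\<sigma> t) \<circ> \<sigma> (t + h)\<close> is independent
  of the past and has value \<open>s\<close> with probability the coefficient of \<open>s\<close> in the exponential of
  \<open>h\<close> times the generator. Jumps are composed on the right; as the generator is central, composing
  them on the left gives the same process in law.
\<close>

locale interchange_process = prob_space M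
  for M :: "'a measure" and n :: nat and \<sigma> :: "real \<Rightarrow> 'a \<Rightarrow> (nat \<Rightarrow> nat)" +
  assumes random_variable:
      "\<And>t. 0 \<le> t \<Longrightarrow> \<sigma> t \<in> measurable M (count_space (sym_grp n))"
    and start: "AE \<omega> in M. \<sigma> 0 \<omega> = id"
    and right_continuous:
      "AE \<omega> in M. \<forall>t\<ge>0. eventually (\<lambda>r. \<sigma> r \<omega> = \<sigma> t \<omega>) (at_right t)"
    and finite_dim_distr:
      "\<And>(m::nat) (t :: nat \<Rightarrow> real) (s :: nat \<Rightarrow> (nat \<Rightarrow> nat)).
         t 0 = 0 \<Longrightarrow> s 0 = id \<Longrightarrow> (\<And>i. i < m \<Longrightarrow> t i \<le> t (Suc i)) \<Longrightarrow>
         (\<And>i. i \<le> m \<Longrightarrow> s i \<in> sym_grp n) \<Longrightarrow>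
         complex_of_real (measure M {\<omega> \<in> space M. \<forall>i\<in>{1..m}. \<sigma> (t i) \<omega> = s i}) =
           (\<Prod>i<m. interchange_semigroup n (t (Suc i) - t i) (inv (s i) \<circ> s (Suc i)))"

definition distance_limit :: "real \<Rightarrow> real" where
  "distance_limit c =
     1 - (\<Sum>\<^sub>\<infinity>k\<in>{1::nat..}.
            real k powi (int k - 2) / fact k * (1 / c) * (c * exp (- c)) ^ k)"

lemma finite_sym_grp: "finite (sym_grp n)"
  unfolding sym_grp_def by (rule finite_permutations) simp

lemma galg_power_bound:
  "(\<Sum>s\<in>sym_grp n. norm (galg_power n f k s)) \<le> (\<Sum>s\<in>sym_grp n. norm (f s)) ^ k"
proof (induction k)
  case 0
  have "(\<Sum>s\<in>sym_grp n. norm (galg_power n f 0 s)) = (\<Sum>s\<in>sym_grp n. if s = id then 1 else 0)"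
    by (intro sum.cong) (auto simp: galg_power_def galg_basis_def)
  also have "\<dots> \<le> 1" using finite_sym_grp by (subst sum.delta) auto
  finally show ?case by simp
next
  case (Suc k)
  let ?S = "sym_grp n" and ?g = "galg_power n f k"
  have "(\<Sum>s\<in>?S. norm (galg_power n f (Suc k) s))
      \<le> (\<Sum>s\<in>?S. \<Sum>u\<in>?S. \<Sum>v\<in>?S. if u \<circ> v = s then norm (f u) * norm (?g v) else 0)"
    unfolding galg_power_def funpow.simps o_apply galg_mult_def
    by (intro sum_mono order.trans[OF norm_sum]) (auto simp: norm_mult)
  also have "\<dots> = (\<Sum>u\<in>?S. \<Sum>s\<in>?S. \<Sum>v\<in>?S. if u \<circ> v = s then norm (f u) * norm (?g v) else 0)"
    by (rule sum.swap)
  also have "\<dots> = (\<Sum>u\<in>?S. \<Sum>v\<in>?S. \<Sum>s\<in>?S. if u \<circ> v = s then norm (f u) * norm (?g v) else 0)"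
    by (rule sum.cong[OF refl], rule sum.swap)
  also have "\<dots> \<le> (\<Sum>u\<in>?S. \<Sum>v\<in>?S. norm (f u) * norm (?g v))"
    by (intro sum_mono) (simp add: finite_sym_grp sum.delta)
  also have "\<dots> = (\<Sum>u\<in>?S. norm (f u)) * (\<Sum>v\<in>?S. norm (?g v))"
    by (simp add: sum_product)
  also have "\<dots> \<le> (\<Sum>s\<in>?S. norm (f s)) * (\<Sum>s\<in>?S. norm (f s)) ^ k"
    by (intro mult_left_mono Suc.IH sum_nonneg) auto
  finally show ?case by simp
qed

lemma galg_exp_summable:
  assumes "s \<in> sym_grp n"
  shows "summable (\<lambda>k. galg_power n f k s / fact k)"
proof (rule summable_comparison_test)
  show "summable (\<lambda>k. (\<Sum>s\<in>sym_grp n. norm (f s)) ^ k / fact k)"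
    using summable_exp[of "\<Sum>s\<in>sym_grp n. norm (f s)"] by (simp add: field_simps)
  have "norm (galg_power n f k s) \<le> (\<Sum>s\<in>sym_grp n. norm (f s)) ^ k" for k
    using member_le_sum[OF assms, of "\<lambda>s. norm (galg_power n f k s)"] finite_sym_grp
      galg_power_bound[of n f k] by auto
  then show "\<exists>N. \<forall>k\<ge>N. norm (galg_power n f k s / fact k)
      \<le> (\<Sum>s\<in>sym_grp n. norm (f s)) ^ k / fact k"
    by (auto simp: norm_divide divide_right_mono)
qed

end

(* The transposition length of a permutation is n minus its number of cycles, and the law of
   the process at time t is that of the product of a Poissonian number of uniform transpositions.
   Compare cycles with the connected components of the multigraph of the transpositions used:
   every cycle lies in a component, so there are at least as many cycles. Conversely at most n/K
   cycles have more than K elements, and a cycle with at most K elements that is not a whole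
   component descends from a fragmentation with a piece of size at most K; a uniform
   transposition causes one with probability at most 2K/n, so their expected number is O(K).
   Components are counted by size, again neglecting those with more than K elements. For fixed k,
   the expected number of components of size k is governed by spanning trees, whose number
   k^(k-2) is obtained by Pitman's double counting of growing forests. *)

theory Submission
  imports Defs "HOL-Combinatorics.Orbits"
begin

section \<open>Orbits after composition with a transposition\<close>

text \<open>The obstacle is c > 1, where a component of linear size appears whose cycles are hard to
  describe. Counting blocks instead of their elements avoids this: whatever their shape, at most n/K
  blocks have more than K elements. The cutoff K stays fixed while n grows; the error per vertex is
  then at most 2/K + c K/n, and K is sent to infinity only afterwards. Edges are ordered pairs,
  loops included, each at rate t/2. Every unordered pair occurs twice and a loop acts as the
  identity, so the generator is unchanged, while the alphabet becomes a full square and the words of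
  length m number exactly n^(2m). The Poissonian length makes the edges inside S, those outside S
  and those crossing independent, which gives an exact product formula for the event that S is a
  component. This independence and the exponential of the generator both come down to the same
  binomial convolution.\<close>

lemma orbit_closed:
  assumes "x \<in> T" "\<And>y. y \<in> T \<Longrightarrow> f y \<in> T"
  shows "orbit f x \<subseteq> T"
proof
  fix y assume "y \<in> orbit f x"
  then show "y \<in> T" by induction (auto intro: assms)
qed

lemma orbit_eq_permutation:
  "permutation p \<Longrightarrow> y \<in> orbit p x \<Longrightarrow> orbit p y = orbit p x"
  using cyclic_on_orbit' orbit_cyclic_eq3 by metis

lemma permutation_transpose_comp:
  "permutation p \<Longrightarrow> permutation (Transposition.transpose i j \<circ> p)"
  by (intro permutation_compose permutation_swap_id)

lemma transpose_comp_transpose_comp [simp]: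
  "Transposition.transpose i j \<circ> (Transposition.transpose i j \<circ> p) = p"
  by (simp flip: o_assoc add: fun_eq_iff)

lemma orbit_transpose_other:
  assumes "permutation p" "i \<notin> orbit p x" "j \<notin> orbit p x"
  shows "orbit (Transposition.transpose i j \<circ> p) x = orbit p x"
proof (rule orbit_cong)
  show "x \<in> orbit p x" using assms(1) by (rule permutation_self_in_orbit)
  fix s assume "s \<in> orbit p x"
  then have "p s \<in> orbit p x" by (rule orbit.step)
  with assms have "p s \<noteq> i" "p s \<noteq> j" by auto
  then show "(Transposition.transpose i j \<circ> p) s = p s" by simp
qed

lemma orbit_transpose_Un_subset:
  assumes "permutation p"
  shows "orbit (Transposition.transpose i j \<circ> p) i \<union> orbit (Transposition.transpose i j \<circ> p) j
    \<subseteq> orbit p i \<union> orbit p j"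
proof -
  have self: "i \<in> orbit p i" "j \<in> orbit p j"
    using assms by (auto intro: permutation_self_in_orbit)
  have "orbit (Transposition.transpose i j \<circ> p) x \<subseteq> orbit p i \<union> orbit p j"
    if "x \<in> {i, j}" for x
  proof (rule orbit_closed)
    show "x \<in> orbit p i \<union> orbit p j" using that self by auto
    fix y assume "y \<in> orbit p i \<union> orbit p j"
    then have "p y \<in> orbit p i \<union> orbit p j" by (auto intro: orbit.step)
    then show "(Transposition.transpose i j \<circ> p) y \<in> orbit p i \<union> orbit p j"
      using self by (auto simp: Transposition.transpose_def)
  qed
  then show ?thesis by blast
qed

text \<open>Composing twice with the same transposition gives \<open>p\<close> back, so the
  one-sided inclusion applied to the composed permutation is the reverse inclusion.\<close>

lemma orbit_transpose_Un:
  assumes "permutation p"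
  shows "orbit (Transposition.transpose i j \<circ> p) i \<union> orbit (Transposition.transpose i j \<circ> p) j
    = orbit p i \<union> orbit p j"
  using orbit_transpose_Un_subset[OF assms, of i j]
    orbit_transpose_Un_subset[OF permutation_transpose_comp[OF assms, of i j], of i j]
  by auto

text \<open>The new cycle of \<open>i\<close> follows \<open>p\<close> until the step that would
  reach \<open>j\<close>, where the transposition sends it back to \<open>i\<close>. It is thus the
  arc of the old cycle from \<open>i\<close> to just before \<open>j\<close>, and its size is the
  distance from \<open>i\<close> to \<open>j\<close>.\<close>

lemma orbit_transpose_split:
  assumes p: "permutation p" and j: "j \<in> orbit p i" and "i \<noteq> j"
  shows "orbit (Transposition.transpose i j \<circ> p) i = (\<lambda>q. (p ^^ q) i) ` {..<funpow_dist p i j}"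
    and "card (orbit (Transposition.transpose i j \<circ> p) i) = funpow_dist p i j"
    and "j \<notin> orbit (Transposition.transpose i j \<circ> p) i"
proof -
  let ?r = "funpow_dist p i j" and ?p = "Transposition.transpose i j \<circ> p"
  let ?T = "(\<lambda>q. (p ^^ q) i) ` {..<?r}"
  have rj: "(p ^^ ?r) i = j" using j by (rule funpow_dist_prop)
  have r0: "0 < ?r" using funpow_dist_0_eq[OF j] \<open>i \<noteq> j\<close> by simp
  have inj: "inj_on (\<lambda>q. (p ^^ q) i) {0..?r}" using j by (rule inj_on_funpow_dist)
  have step: "?p ((p ^^ q) i) = (p ^^ Suc q) i" if "Suc q < ?r" for q
  proof -
    have "(p ^^ Suc q) i \<noteq> (p ^^ 0) i"
      using inj_onD[OF inj, of "Suc q" 0] that by auto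
    moreover have "(p ^^ Suc q) i \<noteq> (p ^^ ?r) i"
      using inj_onD[OF inj, of "Suc q" ?r] that by auto
    ultimately show ?thesis using rj by (simp add: Transposition.transpose_def)
  qed
  have last: "?p ((p ^^ (?r - 1)) i) = i"
  proof -
    have "p ((p ^^ (?r - 1)) i) = (p ^^ ?r) i"
      using r0 by (metis Suc_diff_1 funpow.simps(2) o_apply)
    then show ?thesis using rj by simp
  qed
  have sub: "orbit ?p i \<subseteq> ?T"
  proof (rule orbit_closed)
    show "i \<in> ?T" using r0 by (auto intro!: image_eqI[of _ _ 0])
    fix y assume "y \<in> ?T"
    then obtain q where q: "q < ?r" "y = (p ^^ q) i" by auto
    show "?p y \<in> ?T"
    proof (cases "Suc q < ?r")
      case True then show ?thesis using step q by blast
    next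
      case False
      then have "q = ?r - 1" using q by auto
      then show ?thesis using q last \<open>i \<in> ?T\<close> by simp
    qed
  qed
  have self: "i \<in> orbit ?p i"
    using permutation_transpose_comp[OF p] by (rule permutation_self_in_orbit)
  have "q < ?r \<Longrightarrow> (p ^^ q) i \<in> orbit ?p i" for q
  proof (induction q)
    case 0 then show ?case using self by (metis funpow_0)
  next
    case (Suc q) then show ?case using step[of q] by (metis Suc_lessD orbit.step)
  qed
  with sub show eq: "orbit ?p i = ?T" by auto
  have inj': "inj_on (\<lambda>q. (p ^^ q) i) {..<?r}" by (rule inj_on_subset[OF inj]) auto
  then show "card (orbit ?p i) = ?r" unfolding eq by (simp add: card_image)
  show "j \<notin> orbit ?p i"
  proof
    assume "j \<in> orbit ?p i"
    then obtain q where "q < ?r" "(p ^^ q) i = (p ^^ ?r) i" unfolding eq rj by auto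
    then show False using inj_onD[OF inj, of q ?r] by auto
  qed
qed

text \<open>From \<open>j\<close> the new permutation runs through the whole old cycle of
  \<open>j\<close>; the step that would close it leads to \<open>i\<close> instead. Hence
  \<open>i\<close> and \<open>j\<close> share an orbit, which must be the invariant union.\<close>

lemma orbit_transpose_merge:
  assumes p: "permutation p" and j: "j \<notin> orbit p i"
  shows "orbit (Transposition.transpose i j \<circ> p) i = orbit p i \<union> orbit p j"
    and "orbit (Transposition.transpose i j \<circ> p) j = orbit p i \<union> orbit p j"
proof -
  let ?p = "Transposition.transpose i j \<circ> p"
  have p': "permutation ?p" using p by (rule permutation_transpose_comp)
  \<comment> \<open>The length of the cycle of \<open>j\<close>; \<open>funpow_dist p j j\<close>
    would be 0.\<close>
  let ?s = "funpow_dist1 p j j"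
  have jj: "j \<in> orbit p j" using p by (rule permutation_self_in_orbit)
  have ij': "i \<notin> orbit p j"
    using j jj orbit_eq_permutation[OF p] by metis
  have inj: "inj_on (\<lambda>q. (p ^^ q) j) {0..<?s}" using jj by (rule inj_on_funpow_dist1)
  have walk: "q < ?s \<Longrightarrow> (p ^^ q) j \<in> orbit ?p j" for q
  proof (induction q)
    case 0 then show ?case using permutation_self_in_orbit[OF p'] by (metis funpow_0)
  next
    case (Suc q)
    have "(p ^^ Suc q) j \<noteq> (p ^^ 0) j" using inj_onD[OF inj, of "Suc q" 0] Suc.prems by auto
    moreover have "(p ^^ Suc q) j \<noteq> i" using ij' by (metis funpow_in_orbit jj)
    ultimately have "?p ((p ^^ q) j) = (p ^^ Suc q) j" by simp
    then show ?case using Suc by (metis Suc_lessD orbit.step)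
  qed
  have "?p ((p ^^ (?s - 1)) j) \<in> orbit ?p j" by (intro orbit.step walk) simp
  moreover have "?p ((p ^^ (?s - 1)) j) = i"
    using funpow_dist1_prop[OF jj] by simp
  ultimately have mem: "i \<in> orbit ?p j" by simp
  have "orbit ?p i = orbit ?p j" using orbit_eq_permutation[OF p' mem] .
  with orbit_transpose_Un[OF p, of i j]
  show "orbit ?p i = orbit p i \<union> orbit p j" "orbit ?p j = orbit p i \<union> orbit p j" by auto
qed

section \<open>Components and small orbits of a product of transpositions\<close>

fun transposition_prod :: "('a \<times> 'a) list \<Rightarrow> 'a \<Rightarrow> 'a" where
  "transposition_prod [] = id"
| "transposition_prod ((i, j) # l) = Transposition.transpose i j \<circ> transposition_prod l"

text \<open>The connected component of a vertex in the multigraph with the given edge list. The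
  recursion adds one edge at the head, in step with \<open>transposition_prod\<close>, so that
  cycles and components can be compared edge by edge.\<close>

fun component :: "('a \<times> 'a) list \<Rightarrow> 'a \<Rightarrow> 'a set" where
  "component [] x = {x}"
| "component ((i, j) # l) x =
     (if x \<in> component l i \<union> component l j then component l i \<union> component l j
      else component l x)"

lemma permutation_transposition_prod: "permutation (transposition_prod l)"
proof (induction l)
  case Nil then show ?case by simp
next
  case (Cons e l)
  then show ?case by (metis permutation_transpose_comp surj_pair transposition_prod.simps(2))
qed

lemma transposition_prod_permutes:
  "set l \<subseteq> V \<times> V \<Longrightarrow> transposition_prod l permutes V"
proof (induction l)
  case Nil then show ?case using permutes_id by (metis transposition_prod.simps(1))
next
  case (Cons e l)
  obtain i j where e: "e = (i, j)" by force
  from Cons have "transposition_prod l permutes V" "i \<in> V" "j \<in> V" by (auto simp: e)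
  then show ?case unfolding e transposition_prod.simps
    by (intro permutes_compose permutes_swap_id)
qed

lemma component_self: "x \<in> component l x"
proof (induction l)
  case (Cons e l) then show ?case by (cases e) auto
qed simp

lemma component_eq: "y \<in> component l x \<Longrightarrow> component l y = component l x"
proof (induction l arbitrary: x y)
  case (Cons e l)
  obtain i j where e: "e = (i, j)" by force
  let ?U = "component l i \<union> component l j"
  show ?case
  proof (cases "x \<in> ?U")
    case True then show ?thesis using Cons.prems by (simp add: e)
  next
    case False
    then have y: "y \<in> component l x" using Cons.prems by (simp add: e)
    have "y \<notin> ?U"
    proof
      assume "y \<in> ?U"
      then have "component l y \<subseteq> ?U" using Cons.IH by blast
      then show False using False Cons.IH[OF y] component_self[of x l] by auto
    qed
    then show ?thesis using False Cons.IH[OF y] by (simp add: e)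
  qed
qed simp

lemma in_component_iff: "y \<in> component l x \<longleftrightarrow> component l y = component l x"
  using component_self component_eq by metis

lemma component_subset: "set l \<subseteq> V \<times> V \<Longrightarrow> x \<in> V \<Longrightarrow> component l x \<subseteq> V"
proof (induction l arbitrary: x)
  case (Cons e l)
  obtain i j where e: "e = (i, j)" by force
  from Cons.prems have "set l \<subseteq> V \<times> V" "i \<in> V" "j \<in> V" by (auto simp: e)
  then show ?case using Cons.IH[of i] Cons.IH[of j] Cons.IH[of x] Cons.prems(2) by (simp add: e)
qed simp

lemma component_Cons_mono: "component l x \<subseteq> component (e # l) x"
proof -
  obtain i j where e: "e = (i, j)" by force
  show ?thesis using component_eq[of x l i] component_eq[of x l j] by (auto simp: e)
qed

lemma component_Cons_self: "component ((i, i) # l) = component l"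
  using component_eq by (force simp: fun_eq_iff)

lemma transposition_prod_in_component: "transposition_prod l y \<in> component l y"
proof (induction l)
  case (Cons e l)
  obtain i j where e: "e = (i, j)" by force
  let ?z = "transposition_prod l y"
  have z: "component l ?z = component l y" using Cons.IH by (rule component_eq)
  show ?case
  proof (cases "?z \<in> {i, j}")
    case True
    then have "y \<in> component l i \<union> component l j" using z component_self[of y l] by auto
    then show ?thesis using True component_self[of i l] component_self[of j l] by (auto simp: e)
  next
    case False
    then have "transposition_prod (e # l) y = ?z" by (simp add: e)
    then show ?thesis using Cons.IH component_Cons_mono[of l y e] by auto
  qed
qed simp

lemma orbit_subset_component: "orbit (transposition_prod l) x \<subseteq> component l x"
proof (rule orbit_closed)
  show "x \<in> component l x" by (rule component_self)
  fix y assume "y \<in> component l x"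
  then show "transposition_prod l y \<in> component l x"
    using transposition_prod_in_component[of l y] component_eq by metis
qed

lemma component_orbit:
  "y \<in> orbit (transposition_prod l) x \<Longrightarrow> component l y = component l x"
  using orbit_subset_component component_eq by fast

text \<open>An orbit lies in a single component, so the component of an arbitrarily chosen
  representative defines a map from the orbits onto the components.\<close>

lemma card_components_le_card_orbits:
  assumes "finite V"
  shows "card (component l ` V) \<le> card (orbit (transposition_prod l) ` V)"
proof -
  let ?g = "\<lambda>A. component l (SOME x. x \<in> A)"
  have "?g (orbit (transposition_prod l) x) = component l x" for x
  proof -
    have "(SOME y. y \<in> orbit (transposition_prod l) x) \<in> orbit (transposition_prod l) x"
      by (rule someI) (rule permutation_self_in_orbit[OF permutation_transposition_prod])
    then show ?thesis by (rule component_orbit)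
  qed
  then have "component l ` V = ?g ` (orbit (transposition_prod l) ` V)"
    by (simp add: image_image)
  then show ?thesis using assms by (metis card_image_le finite_imageI)
qed

text \<open>The blocks are disjoint and the large ones have more than \<open>K\<close> elements
  each. The partition is abstract because orbits and components both need this bound.\<close>

lemma card_large_blocks:
  assumes "finite V" and sub: "\<And>x. x \<in> V \<Longrightarrow> f x \<subseteq> V"
    and self: "\<And>x. x \<in> f x" and eq: "\<And>x y. y \<in> f x \<Longrightarrow> f y = f x"
  shows "K * card {A \<in> f ` V. K < card A} \<le> card V"
proof -
  let ?F = "{A \<in> f ` V. K < card A}"
  have disj: "pairwise disjnt ?F"
  proof (rule pairwiseI)
    fix A B assume "A \<in> ?F" "B \<in> ?F" "A \<noteq> B"
    then obtain x y where "A = f x" "B = f y" by blast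
    then show "disjnt A B" using eq \<open>A \<noteq> B\<close> by (metis disjnt_iff)
  qed
  have fin: "finite ?F" using assms(1) by simp
  have "K * card ?F = (\<Sum>A\<in>?F. K)" by simp
  also have "\<dots> \<le> (\<Sum>A\<in>?F. card A)" by (intro sum_mono) auto
  also have "\<dots> = card (\<Union>?F)"
    using disj sub assms(1) by (intro card_Union_disjoint[symmetric]) (auto intro: finite_subset)
  also have "\<dots> \<le> card V" using sub assms(1) by (intro card_mono) auto
  finally show ?thesis .
qed

section \<open>Small orbits that do not fill their component\<close>

definition small_noncomponents :: "nat \<Rightarrow> 'a set \<Rightarrow> ('a \<times> 'a) list \<Rightarrow> 'a set set" where
  "small_noncomponents K V l =
     {A \<in> orbit (transposition_prod l) ` V. card A \<le> K \<and> A \<notin> component l ` V}"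

lemma card_orbits_le:
  assumes "finite V" "set l \<subseteq> V \<times> V"
  shows "card (orbit (transposition_prod l) ` V) \<le> card (component l ` V)
    + card {A \<in> orbit (transposition_prod l) ` V. K < card A}
    + card (small_noncomponents K V l)"
proof -
  let ?O = "orbit (transposition_prod l) ` V"
  have "?O \<subseteq> (component l ` V \<union> {A \<in> ?O. K < card A}) \<union> small_noncomponents K V l"
    by (auto simp: small_noncomponents_def)
  then have "card ?O \<le> card ((component l ` V \<union> {A \<in> ?O. K < card A}) \<union> small_noncomponents K V l)"
    using assms by (intro card_mono) (auto simp: small_noncomponents_def)
  also have "\<dots> \<le> card (component l ` V \<union> {A \<in> ?O. K < card A}) + card (small_noncomponents K V l)"
    by (rule card_Un_le)
  also have "\<dots> \<le> (card (component l ` V) + card {A \<in> ?O. K < card A}) + card (small_noncomponents K V l)"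
    by (intro add_mono card_Un_le) simp
  finally show ?thesis .
qed

lemma card_large_orbits:
  assumes "finite V" "set l \<subseteq> V \<times> V"
  shows "K * card {A \<in> orbit (transposition_prod l) ` V. K < card A} \<le> card V"
  by (rule card_large_blocks[OF assms(1)
        permutes_orbit_subset[OF transposition_prod_permutes[OF assms(2)]]
        permutation_self_in_orbit[OF permutation_transposition_prod]
        orbit_eq_permutation[OF permutation_transposition_prod]])

lemma card_large_components:
  assumes "finite V" "set l \<subseteq> V \<times> V"
  shows "K * card {A \<in> component l ` V. K < card A} \<le> card V"
  by (rule card_large_blocks[OF assms(1) component_subset[OF assms(2)] component_self component_eq])

text \<open>An orbit avoiding both ends of the new edge was already an orbit. Had it been a
  component, the edge would have left that component alone and it would be one still.\<close>

lemma small_noncomponents_Cons_untouched: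
  assumes A: "A \<in> small_noncomponents K V ((i, j) # l)" and ij: "i \<notin> A" "j \<notin> A"
  shows "A \<in> small_noncomponents K V l"
proof -
  let ?p = "transposition_prod l"
  let ?p' = "Transposition.transpose i j \<circ> ?p"
  have p: "permutation ?p" "permutation ?p'"
    by (auto intro: permutation_transposition_prod permutation_transpose_comp)
  from A obtain x where x: "x \<in> V" "A = orbit ?p' x" "card A \<le> K"
    and nc: "A \<notin> component ((i, j) # l) ` V"
    by (auto simp: small_noncomponents_def)
  have eq: "orbit ?p x = A"
    using orbit_transpose_other[of ?p' i x j] p ij x by simp
  have "A \<notin> component l ` V"
  proof
    assume "A \<in> component l ` V"
    then obtain y where y: "y \<in> V" "A = component l y" by auto
    then have "y \<notin> component l i \<union> component l j"
      using ij component_eq[of y l i] component_eq[of y l j] component_self by fast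
    then have "A = component ((i, j) # l) y" using y by simp
    then show False using nc y by blast
  qed
  then show ?thesis using x eq by (auto simp: small_noncomponents_def)
qed

lemma small_noncomponents_Cons_touched:
  assumes A: "A \<in> small_noncomponents K V ((i, j) # l)" and ij: "i \<in> A \<or> j \<in> A"
  shows "A = orbit (Transposition.transpose i j \<circ> transposition_prod l) i
    \<or> A = orbit (Transposition.transpose i j \<circ> transposition_prod l) j"
proof -
  have "permutation (Transposition.transpose i j \<circ> transposition_prod l)"
    by (auto intro: permutation_transposition_prod permutation_transpose_comp)
  then show ?thesis
    using A ij orbit_eq_permutation by (fastforce simp: small_noncomponents_def)
qed

text \<open>A new small orbit that is not a component arises only by splitting an orbit into pieces one
  of which has size at most \<open>K\<close>: a union of two components is again a component, and otherwise one
  of the merged orbits was already counted.\<close>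

lemma card_small_noncomponents_Cons:
  assumes V: "finite V" and ij: "i \<in> V" "j \<in> V"
  shows "card (small_noncomponents K V ((i, j) # l)) \<le> card (small_noncomponents K V l)
    + of_bool (j \<in> (\<lambda>q. (transposition_prod l ^^ q) i) ` {1..K})
    + of_bool (i \<in> (\<lambda>q. (transposition_prod l ^^ q) j) ` {1..K})"
proof (cases "i = j")
  case True
  then show ?thesis
    by (simp add: small_noncomponents_def component_Cons_self)
next
  case False
  let ?p = "transposition_prod l"
  let ?p' = "Transposition.transpose i j \<circ> ?p"
  let ?D = "small_noncomponents K V l" and ?D' = "small_noncomponents K V ((i, j) # l)"
  have p: "permutation ?p" "permutation ?p'"
    by (auto intro: permutation_transposition_prod permutation_transpose_comp)
  have fin: "finite ?D" "finite ?D'" using V by (auto simp: small_noncomponents_def)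
  show ?thesis
  proof (cases "j \<in> orbit ?p i")
    case True
    then have True': "i \<in> orbit ?p j" using p orbit_swap permutation_self_in_orbit by metis
    \<comment> \<open>Sets with at most one element, so that their cardinalities act as indicators.
      The piece containing \<open>i\<close> has \<open>funpow_dist ?p i j\<close> elements; if it is
      small, then \<open>j\<close> is reached from \<open>i\<close> within \<open>K\<close> steps,
      and likewise with \<open>i\<close> and \<open>j\<close> exchanged.\<close>
    let ?I = "{A. A = orbit ?p' i \<and> card A \<le> K}" and ?J = "{A. A = orbit ?p' j \<and> card A \<le> K}"
    have fIJ: "finite ?I" "finite ?J" by auto
    have "?D' \<subseteq> (?D \<union> ?I) \<union> ?J"
      using small_noncomponents_Cons_untouched[of _ K V i j l]
        small_noncomponents_Cons_touched[of _ K V i j l]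
      by (auto simp: small_noncomponents_def)
    then have "card ?D' \<le> card ((?D \<union> ?I) \<union> ?J)" using fin fIJ by (intro card_mono) auto
    also have "\<dots> \<le> (card ?D + card ?I) + card ?J"
      by (intro order.trans[OF card_Un_le] add_mono card_Un_le) simp
    finally have le: "card ?D' \<le> card ?D + card ?I + card ?J" .
    have cI: "card ?I \<le> of_bool (j \<in> (\<lambda>q. (?p ^^ q) i) ` {1..K})"
    proof (cases "card (orbit ?p' i) \<le> K")
      case small: True
      have "funpow_dist ?p i j \<in> {1..K}"
        using small orbit_transpose_split(2)[OF p(1) True False] funpow_dist_0_eq[OF True] False
        by (auto simp del: One_nat_def simp: Suc_le_eq)
      then have "j \<in> (\<lambda>q. (?p ^^ q) i) ` {1..K}" using funpow_dist_prop[OF True] by force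
      moreover have "card ?I \<le> card {orbit ?p' i}" by (intro card_mono) auto
      then have "card ?I \<le> 1" by simp
      ultimately show ?thesis by (simp only: of_bool_def if_True)
    next
      case large: False
      then have "?I = {}" by auto
      then show ?thesis by (metis card.empty zero_le)
    qed
    have swap: "Transposition.transpose j i \<circ> ?p = ?p'" by (simp add: transpose_commute)
    have cJ: "card ?J \<le> of_bool (i \<in> (\<lambda>q. (?p ^^ q) j) ` {1..K})"
    proof (cases "card (orbit ?p' j) \<le> K")
      case small: True
      have "funpow_dist ?p j i \<in> {1..K}"
        using small orbit_transpose_split(2)[OF p(1) True'] funpow_dist_0_eq[OF True'] False swap
        by (auto simp del: One_nat_def simp: Suc_le_eq)
      then have "i \<in> (\<lambda>q. (?p ^^ q) j) ` {1..K}" using funpow_dist_prop[OF True'] by force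
      moreover have "card ?J \<le> card {orbit ?p' j}" by (intro card_mono) auto
      then have "card ?J \<le> 1" by simp
      ultimately show ?thesis by (simp only: of_bool_def if_True)
    next
      case large: False
      then have "?J = {}" by auto
      then show ?thesis by (metis card.empty zero_le)
    qed
    show ?thesis using le cI cJ by linarith
  next
    case merge: False
    let ?U = "orbit ?p i \<union> orbit ?p j"
    note orb = orbit_transpose_merge[OF p(1) merge]
    have iU: "i \<in> orbit ?p i" "j \<in> orbit ?p j" using p by (auto intro: permutation_self_in_orbit)
    \<comment> \<open>Apart from the merged orbit, every orbit counted in \<open>?D'\<close> avoids
      \<open>i\<close> and \<open>j\<close>; the two old orbits no longer exist.\<close>
    have sub: "?D' - {?U} \<subseteq> ?D - {orbit ?p i, orbit ?p j}"
    proof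
      fix A assume A: "A \<in> ?D' - {?U}"
      then have "i \<notin> A" "j \<notin> A"
        using small_noncomponents_Cons_touched[of A K V i j l] orb by auto
      then show "A \<in> ?D - {orbit ?p i, orbit ?p j}"
        using A small_noncomponents_Cons_untouched[of A K V i j l] iU by auto
    qed
    have "card ?D' \<le> card ?D"
    proof (cases "?U \<in> ?D'")
      case True
      then have cU: "card ?U \<le> K" and nU: "?U \<notin> component ((i, j) # l) ` V"
        by (auto simp: small_noncomponents_def)
      have finU: "finite ?U"
        using p iU by (auto intro: finite_orbit)
      have c: "card (orbit ?p i) \<le> K" "card (orbit ?p j) \<le> K"
        using cU card_mono[OF finU, of "orbit ?p i"] card_mono[OF finU, of "orbit ?p j"] by auto
      have "orbit ?p i \<in> ?D \<or> orbit ?p j \<in> ?D"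
      proof (rule ccontr)
        assume "\<not> ?thesis"
        then have "orbit ?p i \<in> component l ` V" "orbit ?p j \<in> component l ` V"
          using c ij by (auto simp: small_noncomponents_def)
        then obtain y z where "orbit ?p i = component l y" "orbit ?p j = component l z" by blast
        then have "orbit ?p i = component l i" "orbit ?p j = component l j"
          using iU component_eq by metis+
        then have "?U = component ((i, j) # l) i" using iU by auto
        then show False using nU ij by blast
      qed
      then have "?D - {orbit ?p i, orbit ?p j} \<subset> ?D" by auto
      then have "card (?D - {orbit ?p i, orbit ?p j}) < card ?D"
        using fin by (intro psubset_card_mono) auto
      moreover have "card (?D' - {?U}) \<le> card (?D - {orbit ?p i, orbit ?p j})"
        using sub fin by (intro card_mono) auto
      moreover have "card ?D' = Suc (card (?D' - {?U}))" by (rule card.remove[OF fin(2) True])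
      ultimately show ?thesis by linarith
    next
      case False
      then have "?D' \<subseteq> ?D" using sub by auto
      then show ?thesis using fin by (intro card_mono) auto
    qed
    then show ?thesis by linarith
  qed
qed

section \<open>Averages over words of edges\<close>

definition words :: "'b set \<Rightarrow> nat \<Rightarrow> 'b list set" where
  "words E m = {l. set l \<subseteq> E \<and> length l = m}"

lemma finite_words: "finite E \<Longrightarrow> finite (words E m)"
  unfolding words_def by (rule finite_lists_length_eq)

lemma card_words: "finite E \<Longrightarrow> card (words E m) = card E ^ m"
  unfolding words_def by (rule card_lists_length_eq)

lemma words_0: "words E 0 = {[]}"
  by (auto simp: words_def)

lemma sum_words_Suc:
  "(\<Sum>l\<in>words E (Suc m). f l) = (\<Sum>l\<in>words E m. \<Sum>e\<in>E. f (e # l))"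
proof -
  have "words E (Suc m) = (\<lambda>(l, e). e # l) ` (words E m \<times> E)"
    by (force simp: words_def length_Suc_conv)
  moreover have "inj_on (\<lambda>(l, e). e # l) (words E m \<times> E)" by (auto simp: inj_on_def)
  ultimately have "(\<Sum>l\<in>words E (Suc m). f l) = (\<Sum>(l, e)\<in>words E m \<times> E. f (e # l))"
    by (simp add: sum.reindex case_prod_unfold)
  then show ?thesis by (simp add: sum.cartesian_product)
qed

text \<open>From each \<open>i\<close> at most \<open>K\<close> points are reached in 1 to
  \<open>K\<close> steps. Divided by the \<open>card V ^ 2\<close> ordered pairs, this is the chance
  of a small fragmentation seen from one end of the edge.\<close>

lemma sum_of_bool_image_le:
  assumes "finite V"
  shows "(\<Sum>i\<in>V. \<Sum>j\<in>V. of_bool (j \<in> g i ` {1..K})) \<le> card V * (K :: nat)"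
proof -
  have "(\<Sum>j\<in>V. of_bool (j \<in> g i ` {1..K})) \<le> K" for i
  proof -
    have "(\<Sum>j\<in>V. of_bool (j \<in> g i ` {1..K})) = card (V \<inter> g i ` {1..K})"
      using assms by (simp add: Int_def)
    also have "\<dots> \<le> card (g i ` {1..K})" by (intro card_mono) auto
    also have "\<dots> \<le> K" using card_image_le[of "{1..K}" "g i"] by simp
    finally show ?thesis .
  qed
  then show ?thesis using sum_mono[of V "\<lambda>i. \<Sum>j\<in>V. of_bool (j \<in> g i ` {1..K})" "\<lambda>_. K"] by simp
qed

text \<open>Over all choices of the next edge the two indicators add up to at most
  \<open>2 * card V * K\<close>, so on average each letter adds at most
  \<open>2 * K / card V\<close>. The factor \<open>card V\<close> stands on the left to keep the
  bound in the natural numbers.\<close>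

lemma sum_card_small_noncomponents:
  assumes V: "finite V"
  shows "card V * (\<Sum>l\<in>words (V \<times> V) m. card (small_noncomponents K V l))
    \<le> 2 * K * m * (card V ^ 2) ^ m"
proof (induction m)
  case 0
  have "small_noncomponents K V [] = {}"
    by (auto simp: small_noncomponents_def orbit_eq_singleton_iff[THEN iffD2])
  then show ?case by (simp add: words_0)
next
  case (Suc m)
  let ?n = "card V" and ?d = "\<lambda>l. card (small_noncomponents K V l)"
  let ?W = "words (V \<times> V) m"
  let ?b = "\<lambda>l i j. of_bool (j \<in> (\<lambda>q. (transposition_prod l ^^ q) i) ` {1..K}) :: nat"
  have step: "(\<Sum>e\<in>V \<times> V. ?d (e # l)) \<le> ?n\<^sup>2 * ?d l + 2 * (?n * K)" for l
  proof -
    have "(\<Sum>e\<in>V \<times> V. ?d (e # l)) = (\<Sum>i\<in>V. \<Sum>j\<in>V. ?d ((i, j) # l))"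
      by (simp add: sum.cartesian_product case_prod_unfold)
    also have "\<dots> \<le> (\<Sum>i\<in>V. \<Sum>j\<in>V. ?d l + ?b l i j + ?b l j i)"
      by (intro sum_mono card_small_noncomponents_Cons V)
    also have "\<dots> = ?n\<^sup>2 * ?d l + (\<Sum>i\<in>V. \<Sum>j\<in>V. ?b l i j) + (\<Sum>j\<in>V. \<Sum>i\<in>V. ?b l j i)"
      by (subst (3) sum.swap) (simp only: sum.distrib sum_constant, simp add: power2_eq_square)
    also have "\<dots> \<le> ?n\<^sup>2 * ?d l + ?n * K + ?n * K"
      by (intro add_mono order.refl sum_of_bool_image_le V)
    finally show ?thesis by simp
  qed
  have "?n * (\<Sum>l\<in>words (V \<times> V) (Suc m). ?d l) \<le> ?n * (\<Sum>l\<in>?W. ?n\<^sup>2 * ?d l + 2 * (?n * K))"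
    unfolding sum_words_Suc by (intro mult_left_mono sum_mono step) simp
  also have "\<dots> = ?n\<^sup>2 * (?n * (\<Sum>l\<in>?W. ?d l)) + 2 * K * ?n\<^sup>2 * card ?W"
    by (simp add: sum.distrib sum_distrib_left algebra_simps power2_eq_square)
  also have "card ?W = (?n\<^sup>2) ^ m"
    using V by (simp add: card_words card_cartesian_product power2_eq_square)
  also have "?n\<^sup>2 * (?n * (\<Sum>l\<in>?W. ?d l)) \<le> ?n\<^sup>2 * (2 * K * m * (?n\<^sup>2) ^ m)"
    by (intro mult_left_mono Suc.IH) simp
  also have "?n\<^sup>2 * (2 * K * m * (?n\<^sup>2) ^ m) + 2 * K * ?n\<^sup>2 * (?n\<^sup>2) ^ m
      = 2 * K * Suc m * (?n\<^sup>2) ^ Suc m"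
    by (simp add: algebra_simps)
  finally show ?case by simp
qed

section \<open>Counting trees and isolated components\<close>

lemma component_image_Cons:
  assumes "i \<in> S" "j \<in> S"
  shows "component ((i, j) # l) ` S =
    insert (component l i \<union> component l j) (component l ` S - {component l i, component l j})"
proof (intro set_eqI iffI)
  fix A assume "A \<in> component ((i, j) # l) ` S"
  then obtain x where x: "x \<in> S" "A = component ((i, j) # l) x" by blast
  then show "A \<in> insert (component l i \<union> component l j)
      (component l ` S - {component l i, component l j})"
    using component_self[of x l] by (cases "x \<in> component l i \<union> component l j") auto
next
  fix A assume A: "A \<in> insert (component l i \<union> component l j)
    (component l ` S - {component l i, component l j})"
  have "component l i \<union> component l j = component ((i, j) # l) i"
    using component_self[of i l] by simp
  moreover have "component l x = component ((i, j) # l) x"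
    if "component l x \<notin> {component l i, component l j}" for x
  proof -
    have "x \<notin> component l i \<union> component l j"
      using that component_eq[of x l i] component_eq[of x l j] by auto
    then show ?thesis by simp
  qed
  ultimately show "A \<in> component ((i, j) # l) ` S"
    using A assms(1) by (elim insertE DiffE imageE) (simp_all del: component.simps, blast)
qed

lemma component_Un_notin:
  assumes "component l i \<noteq> component l j"
  shows "component l i \<union> component l j \<notin> component l ` S"
proof
  assume "component l i \<union> component l j \<in> component l ` S"
  then obtain x where "component l i \<union> component l j = component l x" by auto
  then have "component l i = component l x" "component l j = component l x"
    using component_self component_eq by (metis UnCI)+
  then show False using assms by simp
qed

lemma component_image_Cons_same:
  assumes "i \<in> S" "j \<in> S" "component l i = component l j"
  shows "component ((i, j) # l) ` S = component l ` S"
  using assms component_image_Cons[OF assms(1,2), of l] by auto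

text \<open>Two factors are replaced by one, so the product changes by a ratio depending only on the
  two joined components. The weight is kept general here and becomes the component size in the count
  of forests.\<close>

lemma prod_component_Cons:
  fixes f :: "'a set \<Rightarrow> 'b :: field"
  assumes S: "finite S" "i \<in> S" "j \<in> S" and ne: "component l i \<noteq> component l j"
    and f: "f (component l i) \<noteq> 0" "f (component l j) \<noteq> 0"
  shows "(\<Prod>A\<in>component ((i, j) # l) ` S. f A) = (\<Prod>A\<in>component l ` S. f A)
      * (f (component l i \<union> component l j) / (f (component l i) * f (component l j)))"
    and "card (component l ` S) = Suc (card (component ((i, j) # l) ` S))"
proof -
  let ?F = "component l ` S" and ?I = "component l i" and ?J = "component l j"
  have fin: "finite ?F" using S by simp
  have mem: "?I \<in> ?F" "?J \<in> ?F - {?I}" using S ne by auto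
  have eq: "?F - {?I, ?J} = ?F - {?I} - {?J}" by auto
  have nm: "?I \<union> ?J \<notin> ?F - {?I} - {?J}" using component_Un_notin[OF ne, of S] by auto
  have "prod f ?F = f ?I * (f ?J * prod f (?F - {?I} - {?J}))"
    using prod.remove[OF fin mem(1), of f] prod.remove[OF _ mem(2), of f] fin by simp
  then show "(\<Prod>A\<in>component ((i, j) # l) ` S. f A) = (\<Prod>A\<in>?F. f A)
      * (f (?I \<union> ?J) / (f ?I * f ?J))"
    unfolding component_image_Cons[OF S(2,3)] eq
    using nm fin f by (simp add: field_simps)
  have "card ?F = Suc (Suc (card (?F - {?I} - {?J})))"
    using card.remove[OF fin mem(1)] card.remove[OF _ mem(2)] fin by simp
  then show "card ?F = Suc (card (component ((i, j) # l) ` S))"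
    unfolding component_image_Cons[OF S(2,3)] eq using nm fin by simp
qed

lemma card_component_Cons_ge:
  assumes "finite S" "i \<in> S" "j \<in> S"
  shows "card (component l ` S) \<le> Suc (card (component ((i, j) # l) ` S))"
proof (cases "component l i = component l j")
  case True
  then show ?thesis using component_image_Cons_same[OF assms(2,3)] by simp
next
  case False
  then show ?thesis using prod_component_Cons(2)[OF assms False, of "\<lambda>_. 1 :: real"] by simp
qed

text \<open>An edge lowers the number of components by at most one. Equality holds exactly when
  every edge joined two different components, which is how forests are recognised below.\<close>

lemma card_components_plus_length:
  assumes "finite S"
  shows "set l \<subseteq> S \<times> S \<Longrightarrow> card S \<le> card (component l ` S) + length l"
proof (induction l)
  case Nil then show ?case by (simp add: card_image)
next
  case (Cons e l)
  obtain i j where e: "e = (i, j)" by force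
  show ?case using Cons card_component_Cons_ge[OF assms, of i j l] by (auto simp: e)
qed

lemma component_fibre:
  assumes "set l \<subseteq> S \<times> S" "A \<in> component l ` S"
  shows "{x \<in> S. component l x = A} = A"
proof -
  obtain y where y: "y \<in> S" "A = component l y" using assms by blast
  then have "A \<subseteq> S" using component_subset[OF assms(1)] by simp
  then show ?thesis using y component_eq[of _ l y] component_self by fast
qed

text \<open>A component with a elements contributes a summands 1/a.\<close>

lemma sum_inverse_card_component:
  assumes "finite S" "set l \<subseteq> S \<times> S"
  shows "(\<Sum>x\<in>S. 1 / real (card (component l x))) = card (component l ` S)"
proof -
  have "(\<Sum>x\<in>S. 1 / real (card (component l x)))
      = (\<Sum>A\<in>component l ` S. \<Sum>x\<in>{x\<in>S. component l x = A}. 1 / real (card (component l x)))"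
    by (rule sum.image_gen[OF assms(1)])
  also have "\<dots> = (\<Sum>A\<in>component l ` S. 1)"
  proof (rule sum.cong[OF refl])
    fix A assume A: "A \<in> component l ` S"
    have "A \<subseteq> S" "A \<noteq> {}" using A component_subset[OF assms(2)] component_self by fast+
    then have "card A \<noteq> 0" using assms(1) finite_subset by fastforce
    have "(\<Sum>x\<in>{x\<in>S. component l x = A}. 1 / real (card (component l x)))
        = (\<Sum>x\<in>{x\<in>S. component l x = A}. 1 / real (card A))"
      by (intro sum.cong) auto
    also have "\<dots> = 1" using component_fibre[OF assms(2) A] \<open>card A \<noteq> 0\<close> by simp
    finally show "(\<Sum>x\<in>{x\<in>S. component l x = A}. 1 / real (card (component l x))) = 1" .
  qed
  finally show ?thesis by simp
qed

text \<open>The number of ways to choose a root in every tree of the forest with edge sequence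
  \<open>l\<close>, and 0 if the edges contain a loop or close a cycle.\<close>

definition forest_weight :: "'a set \<Rightarrow> ('a \<times> 'a) list \<Rightarrow> real" where
  "forest_weight S l = (if card (component l ` S) + length l = card S
     then \<Prod>A\<in>component l ` S. real (card A) else 0)"

text \<open>Weighting a forest by the product of its component sizes makes the number of ways to add an
  edge depend only on the number of edges present (Pitman's proof of Cayley's formula).\<close>

lemma sum_forest_weight_Cons:
  assumes S: "finite S" and l: "set l \<subseteq> S \<times> S"
  shows "(\<Sum>e\<in>S \<times> S. forest_weight S (e # l))
    = 2 * real (card S) * (real (card S) - real (length l) - 1) * forest_weight S l"
proof (cases "card (component l ` S) + length l = card S")
  case False
  then have gt: "card S < card (component l ` S) + length l"
    using card_components_plus_length[OF S l] by simp
  have "forest_weight S (e # l) = 0" if e: "e \<in> S \<times> S" for e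
  proof -
    obtain i j where "e = (i, j)" "i \<in> S" "j \<in> S" using e by blast
    then show ?thesis using gt card_component_Cons_ge[OF S, of i j l]
      by (simp add: forest_weight_def del: component.simps)
  qed
  then show ?thesis using False by (simp add: forest_weight_def)
next
  case True
  let ?c = "\<lambda>x. real (card (component l x))" and ?P = "forest_weight S l"
  let ?ne = "\<lambda>i j. component l i \<noteq> component l j"
  have c0: "?c x \<noteq> 0" if "x \<in> S" for x
    using component_subset[OF l that] component_self[of x l] S finite_subset by fastforce
  \<comment> \<open>Joining trees with a and b vertices multiplies the weight by (a + b)/(ab) = 1/a
    + 1/b. The inequality is written in both directions so that the second double sum becomes the
    first after exchanging \<open>i\<close> and \<open>j\<close>.\<close>
  have one: "forest_weight S ((i, j) # l) = ?P * (of_bool (?ne i j) / ?c i + of_bool (?ne j i) / ?c j)"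
    if ij: "i \<in> S" "j \<in> S" for i j
  proof (cases "?ne i j")
    case False
    then show ?thesis using True component_image_Cons_same[OF ij, of l]
      by (simp add: forest_weight_def del: component.simps)
  next
    case ne: True
    note pr = prod_component_Cons[OF S ij ne, of "\<lambda>A. real (card A)", OF c0 c0, OF ij]
    have "component l i \<inter> component l j = {}" using ne component_eq[of _ l i] component_eq[of _ l j] by blast
    moreover have "finite (component l i)" "finite (component l j)"
      using component_subset[OF l] ij S finite_subset by blast+
    ultimately have u: "card (component l i \<union> component l j) = card (component l i) + card (component l j)"
      by (simp add: card_Un_disjoint)
    have "forest_weight S ((i, j) # l)
        = (\<Prod>A\<in>component ((i, j) # l) ` S. real (card A))"
      using True pr(2) by (simp add: forest_weight_def del: component.simps)
    also have "\<dots> = ?P * ((?c i + ?c j) / (?c i * ?c j))"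
      unfolding pr(1) u using True by (simp add: forest_weight_def)
    also have "(?c i + ?c j) / (?c i * ?c j) = 1 / ?c i + 1 / ?c j"
      using c0 ij by (simp add: field_simps)
    finally show ?thesis using ne by (simp add: eq_commute)
  qed
  \<comment> \<open>Each of the \<open>card S - ?c i\<close> vertices outside the tree of
    \<open>i\<close> contributes \<open>1 / ?c i\<close>.\<close>
  have row: "(\<Sum>j\<in>S. of_bool (?ne i j) / ?c i) = real (card S) * (1 / ?c i) - 1" if i: "i \<in> S" for i
  proof -
    have sub: "component l i \<subseteq> S" using component_subset[OF l i] .
    have "{j \<in> S. component l j = component l i} = component l i"
      using i by (intro component_fibre[OF l]) auto
    then have "{j \<in> S. ?ne i j} = S - component l i" by auto
    then have "(\<Sum>j\<in>S. of_bool (?ne i j)) = real (card (S - component l i))"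
      using S by (simp add: Int_def)
    also have "\<dots> = real (card S) - ?c i"
      using sub S by (simp add: card_Diff_subset finite_subset card_mono of_nat_diff)
    finally show ?thesis using c0[OF i] by (simp add: sum_divide_distrib[symmetric] diff_divide_distrib)
  qed
  have "(\<Sum>e\<in>S \<times> S. forest_weight S (e # l)) = (\<Sum>i\<in>S. \<Sum>j\<in>S. forest_weight S ((i, j) # l))"
    by (simp add: sum.cartesian_product case_prod_unfold)
  also have "\<dots> = (\<Sum>i\<in>S. \<Sum>j\<in>S. ?P * (of_bool (?ne i j) / ?c i + of_bool (?ne j i) / ?c j))"
    by (intro sum.cong refl one)
  also have "\<dots> = ?P * ((\<Sum>i\<in>S. \<Sum>j\<in>S. of_bool (?ne i j) / ?c i)
      + (\<Sum>i\<in>S. \<Sum>j\<in>S. of_bool (?ne j i) / ?c j))"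
    by (simp only: sum.distrib sum_distrib_left distrib_left)
  also have "(\<Sum>i\<in>S. \<Sum>j\<in>S. of_bool (?ne j i) / ?c j) = (\<Sum>i\<in>S. \<Sum>j\<in>S. of_bool (?ne i j) / ?c i)"
    by (rule sum.swap)
  also have "(\<Sum>i\<in>S. \<Sum>j\<in>S. of_bool (?ne i j) / ?c i) = (\<Sum>i\<in>S. real (card S) * (1 / ?c i) - 1)"
    by (intro sum.cong refl row)
  also have "\<dots> = real (card S) * (\<Sum>i\<in>S. 1 / ?c i) - card S"
    by (simp only: sum_subtractf sum_distrib_left) simp
  \<comment> \<open>The sum counts the trees, and a forest has as many trees as vertices minus
    edges. This is why the individual sizes disappear from the total.\<close>
  also have "(\<Sum>i\<in>S. 1 / ?c i) = real (card S) - real (length l)"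
    unfolding sum_inverse_card_component[OF S l] using True by linarith
  finally show ?thesis by (simp add: algebra_simps)
qed

lemma sum_forest_weight:
  assumes S: "finite S"
  shows "(\<Sum>l\<in>words (S \<times> S) m. forest_weight S l)
    = (\<Prod>j<m. 2 * real (card S) * (real (card S) - real j - 1))"
proof (induction m)
  case 0
  have "inj_on (component []) S" by (auto simp: inj_on_def)
  then show ?case by (simp add: words_0 forest_weight_def card_image prod.reindex)
next
  case (Suc m)
  have "(\<Sum>l\<in>words (S \<times> S) (Suc m). forest_weight S l)
      = (\<Sum>l\<in>words (S \<times> S) m. 2 * real (card S) * (real (card S) - real m - 1) * forest_weight S l)"
    unfolding sum_words_Suc by (intro sum.cong refl) (auto simp: words_def sum_forest_weight_Cons[OF S])
  then show ?case using Suc by (simp flip: sum_distrib_left)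
qed

definition connecting_words :: "'a set \<Rightarrow> nat \<Rightarrow> ('a \<times> 'a) list set" where
  "connecting_words S m = {l \<in> words (S \<times> S) m. component l ` S = {S}}"

lemma card_connecting_words_le: "finite S \<Longrightarrow> card (connecting_words S m) \<le> (card S ^ 2) ^ m"
proof -
  assume S: "finite S"
  then have "card (connecting_words S m) \<le> card (words (S \<times> S) m)"
    by (intro card_mono finite_words) (auto simp: connecting_words_def)
  then show ?thesis using S by (simp add: card_words card_cartesian_product power2_eq_square)
qed

lemma connecting_words_empty:
  assumes "finite S" "Suc m < card S"
  shows "connecting_words S m = {}"
  using assms card_components_plus_length[OF assms(1)]
  by (fastforce simp: connecting_words_def words_def)

lemma prod_falling: "(\<Prod>j<m. a * (real (Suc m) - real j - 1)) = a ^ m * fact m"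
proof -
  have "(\<Prod>j<m. real (Suc m) - real j - 1) = (\<Prod>j<m. real (Suc (m - Suc j)))"
    by (intro prod.cong) auto
  also have "\<dots> = (\<Prod>j<m. real (Suc j))" by (rule prod.nat_diff_reindex)
  also have "\<dots> = fact m" by (simp add: fact_prod_Suc atLeast0LessThan)
  finally show ?thesis by (simp only: prod.distrib) simp
qed

text \<open>With one edge fewer than vertices, only spanning trees connect \<open>S\<close>, and a
  spanning tree has \<open>card S\<close> rootings. This is Cayley's formula: with k =
  \<open>card S\<close>, each of the k^(k-2) trees is counted with \<open>fact m\<close> orders of
  its edges and \<open>2 ^ m\<close> orientations.\<close>

lemma card_connecting_words_tree:
  assumes S: "finite S" and k: "card S = Suc m"
  shows "real (card S) * real (card (connecting_words S m)) = (2 * real (card S)) ^ m * fact m"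
proof -
  have "forest_weight S l = (if component l ` S = {S} then real (card S) else 0)"
    if l: "l \<in> words (S \<times> S) m" for l
  proof (cases "component l ` S = {S}")
    case True
    have "length l = m" using l by (simp only: words_def mem_Collect_eq)
    then show ?thesis using True k by (simp add: forest_weight_def)
  next
    case False
    have "component l ` S = {S}" if one: "card (component l ` S) = 1"
    proof -
      obtain A where A: "component l ` S = {A}" using one by (rule card_1_singletonE)
      have "{x \<in> S. component l x = A} = A"
        using l A by (intro component_fibre) (simp_all only: words_def mem_Collect_eq insertI1)
      moreover have "{x \<in> S. component l x = A} = S" using A by blast
      ultimately have "A = S" by (simp only:)
      then show ?thesis using A by (simp only:)
    qed
    with False have "card (component l ` S) \<noteq> 1" by (rule contrapos_nn)
    moreover have "length l = m" using l by (simp only: words_def mem_Collect_eq)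
    ultimately have "card (component l ` S) + length l \<noteq> card S" using k by linarith
    then show ?thesis using False by (simp only: forest_weight_def if_False)
  qed
  then have "(\<Sum>l\<in>words (S \<times> S) m. forest_weight S l)
      = (\<Sum>l\<in>words (S \<times> S) m. if component l ` S = {S} then real (card S) else 0)"
    by (intro sum.cong) auto
  also have "\<dots> = real (card S) * real (card (connecting_words S m))"
    using finite_words[of "S \<times> S" m] S by (simp add: sum.If_cases connecting_words_def Int_def)
  finally show ?thesis using sum_forest_weight[OF S, of m] prod_falling[of "2 * real (card S)" m]
    by (simp add: k)
qed

section \<open>Isolated connected sets\<close>

lemma edge_component_eq: "(i, j) \<in> set l \<Longrightarrow> component l i = component l j"
proof (induction l)
  case (Cons e l)
  obtain a b where e: "e = (a, b)" by force
  show ?case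
  proof (cases "(i, j) = (a, b)")
    case True
    then show ?thesis using component_self[of a l] component_self[of b l] by (simp add: e)
  next
    case False
    then have "component l i = component l j" using Cons by (auto simp: e)
    moreover then have "i \<in> component l a \<union> component l b \<longleftrightarrow> j \<in> component l a \<union> component l b"
      by (simp only: Un_iff in_component_iff)
    ultimately show ?thesis by (simp add: e)
  qed
qed simp

lemma component_filter:
  assumes "\<forall>e\<in>set l. e \<in> S \<times> S \<or> e \<in> (- S) \<times> (- S)"
  shows "(x \<in> S \<longrightarrow> component l x = component (filter (\<lambda>e. e \<in> S \<times> S) l) x)
    \<and> (x \<notin> S \<longrightarrow> component l x \<inter> S = {})"
  using assms
proof (induction l arbitrary: x)
  case Nil then show ?case by simp
next
  case (Cons e l)
  obtain i j where e: "e = (i, j)" by force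
  let ?f = "filter (\<lambda>e. e \<in> S \<times> S) l"
  have IH: "y \<in> S \<Longrightarrow> component l y = component ?f y" "y \<notin> S \<Longrightarrow> component l y \<inter> S = {}" for y
    using Cons by auto
  have sub: "y \<in> S \<Longrightarrow> component ?f y \<subseteq> S" for y by (rule component_subset) auto
  consider "i \<in> S" "j \<in> S" | "i \<notin> S" "j \<notin> S" using Cons.prems by (auto simp: e)
  then show ?case
  proof cases
    case 1
    then have "x \<in> S" if "x \<in> component l i \<union> component l j" using that IH sub by blast
    then show ?thesis using 1 IH by (auto simp: e)
  next
    case 2
    then show ?thesis using IH by (auto simp: e)
  qed
qed

text \<open>The event becomes the conjunction of a condition on the crossing edges and one on the
  edges inside \<open>S\<close>. These are independent in the Poissonian model.\<close>

lemma mem_component_image_iff: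
  assumes S: "S \<subseteq> V" "S \<noteq> {}" and l: "set l \<subseteq> V \<times> V"
  shows "S \<in> component l ` V \<longleftrightarrow> set l \<subseteq> S \<times> S \<union> (V - S) \<times> (V - S) \<and>
    component (filter (\<lambda>e. e \<in> S \<times> S) l) ` S = {S}"
proof
  assume "S \<in> component l ` V"
  then obtain y where y: "y \<in> V" "S = component l y" by blast
  have "i \<in> S \<longleftrightarrow> j \<in> S" if "(i, j) \<in> set l" for i j
    using edge_component_eq[OF that] component_self component_eq y by metis
  then have sub: "set l \<subseteq> S \<times> S \<union> (V - S) \<times> (V - S)" using l by auto
  then have "\<forall>e\<in>set l. e \<in> S \<times> S \<or> e \<in> (- S) \<times> (- S)" by blast
  from component_filter[OF this]
  have "component (filter (\<lambda>e. e \<in> S \<times> S) l) x = S" if "x \<in> S" for x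
    using that y component_eq[of x l y] by auto
  then show "set l \<subseteq> S \<times> S \<union> (V - S) \<times> (V - S) \<and>
      component (filter (\<lambda>e. e \<in> S \<times> S) l) ` S = {S}"
    using sub S by auto
next
  assume R: "set l \<subseteq> S \<times> S \<union> (V - S) \<times> (V - S) \<and>
      component (filter (\<lambda>e. e \<in> S \<times> S) l) ` S = {S}"
  obtain x where x: "x \<in> S" using S by blast
  from R have "\<forall>e\<in>set l. e \<in> S \<times> S \<or> e \<in> (- S) \<times> (- S)" by blast
  from component_filter[OF this, of x] R x have "component l x = S" by auto
  then show "S \<in> component l ` V" using x S by blast
qed

text \<open>Pascal's rule. In terms of exponential generating functions it is the product rule for
  A(x) exp(b x), whose derivative is A'(x) exp(b x) + b A(x) exp(b x). It drives the induction both
  for filtered words and for the powers of the generator.\<close>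

lemma binomial_shift:
  fixes a :: "nat \<Rightarrow> 'b :: comm_semiring_1"
  shows "(\<Sum>j\<le>m. of_nat (m choose j) * a (Suc j) * b ^ (m - j))
      + b * (\<Sum>j\<le>m. of_nat (m choose j) * a j * b ^ (m - j))
    = (\<Sum>j\<le>Suc m. of_nat (Suc m choose j) * a j * b ^ (Suc m - j))"
proof -
  have "b * (\<Sum>j\<le>m. of_nat (m choose j) * a j * b ^ (m - j))
      = (\<Sum>j\<le>Suc m. of_nat (m choose j) * a j * b ^ (Suc m - j))"
    by (simp add: sum_distrib_left Suc_diff_le algebra_simps binomial_eq_0)
  also have "\<dots> = a 0 * b ^ Suc m + (\<Sum>j\<le>m. of_nat (m choose Suc j) * a (Suc j) * b ^ (m - j))"
    by (subst sum.atMost_Suc_shift) (simp del: sum.atMost_Suc)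
  finally show ?thesis
    unfolding sum.atMost_Suc_shift[of "\<lambda>j. of_nat (Suc m choose j) * a j * b ^ (Suc m - j)"]
    by (simp add: sum.distrib algebra_simps del: sum.atMost_Suc)
qed

text \<open>A word is given by the positions of its letters from \<open>A\<close>, the subword they
  form, and free letters of \<open>B\<close> elsewhere. The induction removes the first letter; a
  letter \<open>e\<close> of \<open>A\<close> turns \<open>F\<close> into \<open>F (e # l)\<close>,
  so \<open>F\<close> has to vary.\<close>

lemma sum_words_filter:
  fixes F :: "'b list \<Rightarrow> 'c :: comm_semiring_1"
  assumes fin: "finite A" "finite B" and disj: "A \<inter> B = {}"
  shows "(\<Sum>l\<in>words (A \<union> B) m. F (filter (\<lambda>e. e \<in> A) l))
    = (\<Sum>j\<le>m. of_nat (m choose j) * (\<Sum>l\<in>words A j. F l) * of_nat (card B) ^ (m - j))"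
proof (induction m arbitrary: F)
  case 0 then show ?case by (simp add: words_0)
next
  case (Suc m)
  let ?f = "filter (\<lambda>e. e \<in> A)"
  have "(\<Sum>l\<in>words (A \<union> B) (Suc m). F (?f l))
      = (\<Sum>l\<in>words (A \<union> B) m. (\<Sum>e\<in>A. F (e # ?f l)) + of_nat (card B) * F (?f l))"
    unfolding sum_words_Suc
  proof (intro sum.cong refl)
    fix l
    have "(\<Sum>e\<in>B. F (?f (e # l))) = (\<Sum>e\<in>B. F (?f l))"
      using disj by (intro sum.cong) auto
    then show "(\<Sum>e\<in>A \<union> B. F (?f (e # l))) = (\<Sum>e\<in>A. F (e # ?f l)) + of_nat (card B) * F (?f l)"
      by (simp add: sum.union_disjoint[OF fin disj])
  qed
  also have "\<dots> = (\<Sum>l\<in>words (A \<union> B) m. (\<Sum>e\<in>A. F (e # ?f l)))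
      + of_nat (card B) * (\<Sum>l\<in>words (A \<union> B) m. F (?f l))"
    by (simp only: sum.distrib sum_distrib_left)
  finally show ?case
    using Suc.IH[of "\<lambda>l. \<Sum>e\<in>A. F (e # l)"] Suc.IH[of F]
      binomial_shift[of m "\<lambda>j. \<Sum>l\<in>words A j. F l" "of_nat (card B)"]
    by (simp only: sum_words_Suc[symmetric])
qed

section \<open>Means over Poissonian words\<close>

text \<open>Exponential generating functions turn a binomial convolution into a product, here by the
  Cauchy product. This is used to separate letters from disjoint alphabets and to split the scalar
  part off the generator.\<close>

lemma suminf_binomial_exp:
  fixes a :: "nat \<Rightarrow> 'c :: {real_normed_field, banach}"
  assumes "summable (\<lambda>j. norm (a j / fact j))"
  shows "(\<Sum>m. (\<Sum>j\<le>m. of_nat (m choose j) * a j * b ^ (m - j)) / fact m)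
    = (\<Sum>j. a j / fact j) * exp b"
proof -
  have "summable (\<lambda>j. norm (b ^ j / fact j))"
    using summable_norm_exp[of b] by (simp add: scaleR_conv_of_real divide_inverse mult.commute)
  then have "(\<lambda>m. \<Sum>j\<le>m. (a j / fact j) * (b ^ (m - j) / fact (m - j))) sums
      ((\<Sum>j. a j / fact j) * (\<Sum>j. b ^ j / fact j))"
    using assms by (intro Cauchy_product_sums)
  moreover have "(\<Sum>j. b ^ j / fact j) = exp b"
    by (simp add: exp_def scaleR_conv_of_real divide_inverse mult.commute)
  moreover have "(\<Sum>j\<le>m. (a j / fact j) * (b ^ (m - j) / fact (m - j)))
      = (\<Sum>j\<le>m. of_nat (m choose j) * a j * b ^ (m - j)) / fact m" for m
    unfolding sum_divide_distrib
    by (intro sum.cong refl) (simp add: binomial_fact field_simps)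
  ultimately show ?thesis by (simp add: sums_iff)
qed

text \<open>The exponential generating function at \<open>t\<close> of the sums over words of fixed
  length. Without the normalising factor \<open>exp (- (t * card E))\<close> it factorises directly
  when the alphabet is split.\<close>

definition word_sum :: "'b set \<Rightarrow> real \<Rightarrow> ('b list \<Rightarrow> real) \<Rightarrow> real" where
  "word_sum E t F = (\<Sum>m. t ^ m * (\<Sum>l\<in>words E m. F l) / fact m)"

lemma summable_power_fact: "summable (\<lambda>m. (x :: real) ^ m / fact m)"
  using summable_exp[of x] by (simp add: field_simps)

text \<open>There are \<open>card E ^ m\<close> words of length \<open>m\<close>, so for bounded
  \<open>F\<close> the series is dominated by an exponential one. The norm is kept because the
  Cauchy product asks for absolute convergence.\<close>

lemma summable_norm_word_sum:
  assumes "finite E" and F: "\<And>l. set l \<subseteq> E \<Longrightarrow> \<bar>F l\<bar> \<le> C"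
  shows "summable (\<lambda>m. norm (t ^ m * (\<Sum>l\<in>words E m. F l) / fact m :: real))"
proof (rule summable_comparison_test)
  show "summable (\<lambda>m. C * ((\<bar>t\<bar> * real (card E)) ^ m / fact m))"
    by (intro summable_mult summable_power_fact)
  have "\<bar>\<Sum>l\<in>words E m. F l\<bar> \<le> real (card E) ^ m * C" for m
  proof -
    have "\<bar>\<Sum>l\<in>words E m. F l\<bar> \<le> (\<Sum>l\<in>words E m. C)"
      using F by (intro order.trans[OF sum_abs] sum_mono) (auto simp: words_def)
    then show ?thesis using assms(1) by (simp add: card_words)
  qed
  then have "\<bar>t\<bar> ^ m * \<bar>\<Sum>l\<in>words E m. F l\<bar> \<le> C * (\<bar>t\<bar> * real (card E)) ^ m" for m
    using mult_left_mono[of "\<bar>\<Sum>l\<in>words E m. F l\<bar>" "real (card E) ^ m * C" "\<bar>t\<bar> ^ m"]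
    by (simp add: power_mult_distrib algebra_simps)
  then show "\<exists>N. \<forall>m\<ge>N. norm (norm (t ^ m * (\<Sum>l\<in>words E m. F l) / fact m))
      \<le> C * ((\<bar>t\<bar> * real (card E)) ^ m / fact m)"
    by (auto simp: abs_mult power_abs divide_right_mono)
qed

lemma summable_word_sum:
  assumes "finite E" "\<And>l. set l \<subseteq> E \<Longrightarrow> \<bar>F l\<bar> \<le> C"
  shows "summable (\<lambda>m. t ^ m * (\<Sum>l\<in>words E m. F l) / fact m :: real)"
  using summable_norm_word_sum[OF assms] by (rule summable_norm_cancel)

lemma word_sum_cong:
  "(\<And>l. set l \<subseteq> E \<Longrightarrow> F l = G l) \<Longrightarrow> word_sum E t F = word_sum E t G"
proof -
  assume eq: "\<And>l. set l \<subseteq> E \<Longrightarrow> F l = G l"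
  have "(\<Sum>l\<in>words E m. F l) = (\<Sum>l\<in>words E m. G l)" for m
    by (intro sum.cong refl eq) (simp add: words_def)
  then show ?thesis by (simp add: word_sum_def)
qed

lemma word_sum_mono:
  assumes "finite E" "0 \<le> t" "\<And>l. set l \<subseteq> E \<Longrightarrow> F l \<le> G l"
    and "\<And>l. set l \<subseteq> E \<Longrightarrow> \<bar>F l\<bar> \<le> C" "\<And>l. set l \<subseteq> E \<Longrightarrow> \<bar>G l\<bar> \<le> C"
  shows "word_sum E t F \<le> word_sum E t G"
  unfolding word_sum_def using assms
  by (intro suminf_le summable_word_sum[where C = C] divide_right_mono mult_left_mono sum_mono)
    (auto simp: words_def)

lemma word_sum_add:
  assumes "finite E" "\<And>l. set l \<subseteq> E \<Longrightarrow> \<bar>F l\<bar> \<le> C" "\<And>l. set l \<subseteq> E \<Longrightarrow> \<bar>G l\<bar> \<le> C"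
  shows "word_sum E t (\<lambda>l. F l + G l) = word_sum E t F + word_sum E t G"
  unfolding word_sum_def
  by (subst suminf_add[OF summable_word_sum[OF assms(1,2)] summable_word_sum[OF assms(1,3)]])
    (simp_all add: sum.distrib add_divide_distrib distrib_left)

lemma word_sum_cmult:
  assumes "finite E" "\<And>l. set l \<subseteq> E \<Longrightarrow> \<bar>F l\<bar> \<le> C"
  shows "word_sum E t (\<lambda>l. a * F l) = a * word_sum E t F"
  unfolding word_sum_def
  by (subst suminf_mult[OF summable_word_sum[OF assms], symmetric])
    (simp_all add: sum_distrib_left mult_ac)

lemma word_sum_sum:
  assumes "finite E" "finite X" "\<And>x l. x \<in> X \<Longrightarrow> set l \<subseteq> E \<Longrightarrow> \<bar>F x l\<bar> \<le> C x"
  shows "word_sum E t (\<lambda>l. \<Sum>x\<in>X. F x l) = (\<Sum>x\<in>X. word_sum E t (F x))"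
proof -
  have "(\<Sum>x\<in>X. word_sum E t (F x)) = (\<Sum>m. \<Sum>x\<in>X. t ^ m * (\<Sum>l\<in>words E m. F x l) / fact m)"
    unfolding word_sum_def using assms by (intro suminf_sum[symmetric] summable_word_sum) auto
  also have "\<dots> = word_sum E t (\<lambda>l. \<Sum>x\<in>X. F x l)"
  proof -
    have "(\<Sum>x\<in>X. t ^ m * (\<Sum>l\<in>words E m. F x l) / fact m)
        = t ^ m * (\<Sum>l\<in>words E m. \<Sum>x\<in>X. F x l) / fact m" for m
      unfolding sum.swap[of _ X] sum_distrib_left sum_divide_distrib ..
    then show ?thesis by (simp add: word_sum_def)
  qed
  finally show ?thesis ..
qed

lemma word_sum_const:
  assumes "finite E"
  shows "word_sum E t (\<lambda>_. a) = a * exp (t * card E)"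
proof -
  have "(\<lambda>m. a * ((t * real (card E)) ^ m / fact m)) sums (a * exp (t * card E))"
    using exp_converges[of "t * real (card E)"] by (intro sums_mult) (simp add: field_simps)
  then show ?thesis using assms
    by (simp add: word_sum_def card_words sums_iff power_mult_distrib mult_ac)
qed

text \<open>Thinning of a Poissonian word: the letters of \<open>B\<close> are independent of those
  of \<open>A\<close>, and only their total mass \<open>exp (t * card B)\<close> remains.\<close>

lemma word_sum_filter:
  assumes fin: "finite A" "finite B" and disj: "A \<inter> B = {}"
    and F: "\<And>l. set l \<subseteq> A \<Longrightarrow> \<bar>F l\<bar> \<le> C"
  shows "word_sum (A \<union> B) t (\<lambda>l. F (filter (\<lambda>e. e \<in> A) l)) = word_sum A t F * exp (t * card B)"
proof -
  let ?a = "\<lambda>j. t ^ j * (\<Sum>l\<in>words A j. F l)"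
  have "t ^ m * (\<Sum>l\<in>words (A \<union> B) m. F (filter (\<lambda>e. e \<in> A) l))
      = (\<Sum>j\<le>m. of_nat (m choose j) * ?a j * (t * real (card B)) ^ (m - j))" for m
    unfolding sum_words_filter[OF fin disj]
  proof (subst sum_distrib_left, intro sum.cong refl)
    fix j assume "j \<in> {..m}"
    then have "t ^ m = t ^ j * t ^ (m - j)" by (simp flip: power_add)
    then show "t ^ m * (of_nat (m choose j) * (\<Sum>l\<in>words A j. F l) * of_nat (card B) ^ (m - j))
        = of_nat (m choose j) * ?a j * (t * real (card B)) ^ (m - j)"
      by (simp add: power_mult_distrib)
  qed
  then show ?thesis
    unfolding word_sum_def using suminf_binomial_exp[OF summable_norm_word_sum[OF fin(1) F]] by simp
qed

text \<open>The expectation over a Poissonian number, of mean \<open>t * (card V)\<^sup>2\<close>, of uniform edges; loops are allowed, as they change neither the permutation nor the components.\<close>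

definition word_mean :: "'a set \<Rightarrow> real \<Rightarrow> (('a \<times> 'a) list \<Rightarrow> real) \<Rightarrow> real" where
  "word_mean V t F = exp (- (t * (card V)\<^sup>2)) * word_sum (V \<times> V) t F"

lemma word_mean_mono:
  assumes "finite V" "0 \<le> t" "\<And>l. set l \<subseteq> V \<times> V \<Longrightarrow> F l \<le> G l"
    and "\<And>l. set l \<subseteq> V \<times> V \<Longrightarrow> \<bar>F l\<bar> \<le> C" "\<And>l. set l \<subseteq> V \<times> V \<Longrightarrow> \<bar>G l\<bar> \<le> C"
  shows "word_mean V t F \<le> word_mean V t G"
  unfolding word_mean_def using assms by (intro mult_left_mono word_sum_mono[where C = C]) auto

lemma word_mean_add:
  assumes "finite V"
    "\<And>l. set l \<subseteq> V \<times> V \<Longrightarrow> \<bar>F l\<bar> \<le> C" "\<And>l. set l \<subseteq> V \<times> V \<Longrightarrow> \<bar>G l\<bar> \<le> C"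
  shows "word_mean V t (\<lambda>l. F l + G l) = word_mean V t F + word_mean V t G"
  unfolding word_mean_def using assms by (subst word_sum_add[where C = C]) (auto simp: distrib_left)

lemma word_mean_sum:
  assumes "finite V" "finite X" "\<And>x l. x \<in> X \<Longrightarrow> set l \<subseteq> V \<times> V \<Longrightarrow> \<bar>F x l\<bar> \<le> C x"
  shows "word_mean V t (\<lambda>l. \<Sum>x\<in>X. F x l) = (\<Sum>x\<in>X. word_mean V t (F x))"
  unfolding word_mean_def using assms
  by (subst word_sum_sum[where C = C]) (auto simp: sum_distrib_left)

lemma word_mean_cmult:
  assumes "finite V" "\<And>l. set l \<subseteq> V \<times> V \<Longrightarrow> \<bar>F l\<bar> \<le> C"
  shows "word_mean V t (\<lambda>l. a * F l) = a * word_mean V t F"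
  unfolding word_mean_def using assms by (subst word_sum_cmult[where C = C]) auto

lemma word_mean_const: "finite V \<Longrightarrow> word_mean V t (\<lambda>_. a) = a"
  by (simp add: word_mean_def word_sum_const card_cartesian_product power2_eq_square exp_minus)

lemma word_mean_cong:
  "(\<And>l. set l \<subseteq> V \<times> V \<Longrightarrow> F l = G l) \<Longrightarrow> word_mean V t F = word_mean V t G"
  unfolding word_mean_def by (simp cong: word_sum_cong)

text \<open>With n = \<open>card V\<close> and k = \<open>card S\<close>, exactly n^2 - (n-k)^2 =
  2nk - k^2 ordered pairs meet \<open>S\<close>, and the exponential is their normalisation. The
  crossing pairs have to be absent, the pairs inside \<open>S\<close> enter through the unnormalised
  \<open>word_sum\<close>, and the pairs outside average out.\<close>

lemma word_mean_isolated:
  assumes V: "finite V" and S: "S \<subseteq> V" "S \<noteq> {}"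
  shows "word_mean V t (\<lambda>l. of_bool (S \<in> component l ` V))
    = exp (- (t * (2 * real (card V) * card S - (card S)\<^sup>2)))
      * word_sum (S \<times> S) t (\<lambda>l. of_bool (component l ` S = {S}))"
proof -
  let ?A = "S \<times> S" and ?B = "(V - S) \<times> (V - S)"
  let ?G = "\<lambda>l. of_bool (component l ` S = {S}) :: real"
  have fS: "finite S" using V S finite_subset by blast
  have fin: "finite ?A" "finite ?B" using V fS by auto
  have "word_sum (V \<times> V) t (\<lambda>l. of_bool (S \<in> component l ` V))
      = word_sum (?A \<union> ?B) t (\<lambda>l. ?G (filter (\<lambda>e. e \<in> ?A) l))"
  proof -
    \<comment> \<open>A word with an edge between \<open>S\<close> and \<open>V - S\<close>
      contributes 0, so the alphabet shrinks to the pairs inside \<open>S\<close> and those inside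
      its complement.\<close>
    have "(\<Sum>l\<in>words (V \<times> V) m. of_bool (S \<in> component l ` V) :: real)
        = (\<Sum>l\<in>words (?A \<union> ?B) m. ?G (filter (\<lambda>e. e \<in> ?A) l))" for m
    proof (rule sum.mono_neutral_cong_right)
      show "finite (words (V \<times> V) m)" using V by (intro finite_words) auto
      show "words (?A \<union> ?B) m \<subseteq> words (V \<times> V) m" using S unfolding words_def by fast
      show "\<forall>l\<in>words (V \<times> V) m - words (?A \<union> ?B) m. of_bool (S \<in> component l ` V) = (0 :: real)"
        using mem_component_image_iff[OF S] by (auto simp: words_def)
      fix l assume l: "l \<in> words (?A \<union> ?B) m"
      then have "set l \<subseteq> V \<times> V" using S unfolding words_def by fast
      from mem_component_image_iff[OF S this] l
      show "of_bool (S \<in> component l ` V) = ?G (filter (\<lambda>e. e \<in> ?A) l)"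
        by (simp add: words_def)
    qed
    then show ?thesis unfolding word_sum_def by simp
  qed
  also have "\<dots> = word_sum ?A t ?G * exp (t * card ?B)"
    using fin by (intro word_sum_filter[where C = 1]) auto
  finally have eq: "word_mean V t (\<lambda>l. of_bool (S \<in> component l ` V))
      = (exp (- (t * (card V)\<^sup>2)) * exp (t * card ?B)) * word_sum ?A t ?G"
    unfolding word_mean_def by simp
  have le: "card S \<le> card V" using V S by (simp add: card_mono)
  have "real (card ?B) = (real (card V) - real (card S))\<^sup>2"
    using V S fS le by (simp add: card_cartesian_product card_Diff_subset of_nat_diff power2_eq_square)
  then have "exp (- (t * (card V)\<^sup>2)) * exp (t * card ?B)
      = exp (- (t * (2 * real (card V) * card S - (card S)\<^sup>2)))"
    by (simp only: exp_add[symmetric] of_nat_power) (simp add: power2_eq_square algebra_simps)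
  then show ?thesis using eq by simp
qed

text \<open>At least \<open>r\<close> edges are needed to connect \<open>r + 1\<close> vertices, and
  with exactly \<open>r\<close> they form a spanning tree; \<open>L\<close> is the number of such
  words divided by \<open>fact r\<close>. Words with more edges cost a further factor
  \<open>t\<close>, which will be of order 1/n.\<close>

lemma connected_word_sum_bounds:
  fixes S :: "'a set"
  assumes S: "finite S" and k: "card S = Suc r" and t: "0 \<le> t" "t \<le> 1"
  defines "L \<equiv> (2 * real (Suc r)) ^ r / real (Suc r)"
  shows "L * t ^ r \<le> word_sum (S \<times> S) t (\<lambda>l. of_bool (component l ` S = {S}))"
    and "word_sum (S \<times> S) t (\<lambda>l. of_bool (component l ` S = {S}))
      \<le> L * t ^ r + t ^ Suc r * exp ((real (Suc r))\<^sup>2)"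
proof -
  let ?f = "\<lambda>j. t ^ j * real (card (connecting_words S j)) / fact j"
  have fin: "finite (S \<times> S)" using S by simp
  have "(\<Sum>l\<in>words (S \<times> S) j. of_bool (component l ` S = {S}) :: real)
      = card (connecting_words S j)" for j
    using finite_words[OF fin, of j] by (simp add: connecting_words_def Int_def)
  then have W: "word_sum (S \<times> S) t (\<lambda>l. of_bool (component l ` S = {S})) = (\<Sum>j. ?f j)"
    and sm: "summable ?f"
    using summable_word_sum[OF fin, of "\<lambda>l. of_bool (component l ` S = {S})" 1 t]
    by (simp_all add: word_sum_def)
  have z: "?f j = 0" if "j < r" for j
    using connecting_words_empty[OF S, of j] that k by simp
  have fr: "?f r = L * t ^ r"
    using card_connecting_words_tree[OF S k] by (simp add: L_def k field_simps)
  have "(\<Sum>j. ?f j) = (\<Sum>j. ?f (j + Suc r)) + (\<Sum>j<Suc r. ?f j)"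
    by (rule suminf_split_initial_segment[OF sm])
  also have "(\<Sum>j<Suc r. ?f j) = L * t ^ r" using fr by (simp add: sum.neutral z del: divide_eq_0_iff)
  finally have eq: "(\<Sum>j. ?f j) = (\<Sum>j. ?f (j + Suc r)) + L * t ^ r" .
  have sm': "summable (\<lambda>j. ?f (j + Suc r))" using sm by (rule summable_ignore_initial_segment)
  have "0 \<le> (\<Sum>j. ?f (j + Suc r))" using t by (intro suminf_nonneg sm') auto
  then show "L * t ^ r \<le> word_sum (S \<times> S) t (\<lambda>l. of_bool (component l ` S = {S}))"
    unfolding W eq by simp
  let ?e = "\<lambda>j. ((real (Suc r))\<^sup>2) ^ j / fact j"
  \<comment> \<open>For the longer words connectivity is dropped. Since \<open>t \<le> 1\<close>,
    all powers of \<open>t\<close> beyond the first \<open>r + 1\<close> are bounded by 1, and an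
    exponential series depending on \<open>r\<close> alone remains.\<close>
  have "?f (j + Suc r) \<le> t ^ Suc r * ?e (j + Suc r)" for j
  proof -
    have "real (card (connecting_words S (j + Suc r))) \<le> ((real (Suc r))\<^sup>2) ^ (j + Suc r)"
      using card_connecting_words_le[OF S, of "j + Suc r"] unfolding k
      by (metis of_nat_le_iff of_nat_power)
    moreover have "t ^ (j + Suc r) \<le> t ^ Suc r" using t by (intro power_decreasing) auto
    ultimately have "t ^ (j + Suc r) * real (card (connecting_words S (j + Suc r)))
        \<le> t ^ Suc r * ((real (Suc r))\<^sup>2) ^ (j + Suc r)"
      using t by (intro mult_mono) auto
    then show ?thesis unfolding times_divide_eq_right by (intro divide_right_mono) auto
  qed
  then have "(\<Sum>j. ?f (j + Suc r)) \<le> (\<Sum>j. t ^ Suc r * ?e (j + Suc r))"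
    using summable_power_fact by (intro suminf_le sm' summable_mult summable_ignore_initial_segment)
  also have "\<dots> = t ^ Suc r * (\<Sum>j. ?e (j + Suc r))"
    using summable_power_fact by (intro suminf_mult summable_ignore_initial_segment)
  also have "\<dots> \<le> t ^ Suc r * exp ((real (Suc r))\<^sup>2)"
  proof (intro mult_left_mono)
    have "(\<Sum>j. ?e j) = (\<Sum>j. ?e (j + Suc r)) + (\<Sum>j<Suc r. ?e j)"
      by (rule suminf_split_initial_segment[OF summable_power_fact])
    moreover have "0 \<le> (\<Sum>j<Suc r. ?e j)" by (intro sum_nonneg) auto
    moreover have "(\<Sum>j. ?e j) = exp ((real (Suc r))\<^sup>2)"
      by (simp add: exp_def field_simps)
    ultimately show "(\<Sum>j. ?e (j + Suc r)) \<le> exp ((real (Suc r))\<^sup>2)" by linarith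
  qed (use t in auto)
  finally show "word_sum (S \<times> S) t (\<lambda>l. of_bool (component l ` S = {S}))
      \<le> L * t ^ r + t ^ Suc r * exp ((real (Suc r))\<^sup>2)"
    unfolding W eq by simp
qed

lemma word_mean_components_of_size:
  assumes V: "finite V" and k: "k > 0"
  shows "word_mean V t (\<lambda>l. real (card {A \<in> component l ` V. card A = k}))
    = (\<Sum>S | S \<subseteq> V \<and> card S = k. exp (- (t * (2 * real (card V) * k - (real k)\<^sup>2)))
      * word_sum (S \<times> S) t (\<lambda>l. of_bool (component l ` S = {S})))"
proof -
  let ?X = "{S. S \<subseteq> V \<and> card S = k}"
  have fX: "finite ?X" using V by simp
  have "word_mean V t (\<lambda>l. real (card {A \<in> component l ` V. card A = k}))
      = word_mean V t (\<lambda>l. \<Sum>S\<in>?X. of_bool (S \<in> component l ` V))"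
  proof (rule word_mean_cong)
    fix l :: "('a \<times> 'a) list" assume "set l \<subseteq> V \<times> V"
    then have "{A \<in> component l ` V. card A = k} = {S \<in> ?X. S \<in> component l ` V}"
      using component_subset[of l V] by auto
    then show "real (card {A \<in> component l ` V. card A = k})
        = (\<Sum>S\<in>?X. of_bool (S \<in> component l ` V))"
      using fX by (simp add: Int_def)
  qed
  also have "\<dots> = (\<Sum>S\<in>?X. word_mean V t (\<lambda>l. of_bool (S \<in> component l ` V)))"
    using V fX by (intro word_mean_sum[where C = "\<lambda>_. 1"]) auto
  also have "\<dots> = (\<Sum>S\<in>?X. exp (- (t * (2 * real (card V) * k - (real k)\<^sup>2)))
      * word_sum (S \<times> S) t (\<lambda>l. of_bool (component l ` S = {S})))"
    using k by (intro sum.cong refl) (subst word_mean_isolated[OF V], auto)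
  finally show ?thesis .
qed

lemma word_mean_components_of_size_bounds:
  assumes V: "finite V" and t: "0 \<le> t" "t \<le> 1"
  defines "L \<equiv> \<lambda>r. (2 * real (Suc r)) ^ r / real (Suc r)"
    and "P \<equiv> \<lambda>r. real (card V choose Suc r)
      * exp (- (t * (2 * real (card V) * real (Suc r) - (real (Suc r))\<^sup>2)))"
  shows "P r * (L r * t ^ r) \<le> word_mean V t (\<lambda>l. real (card {A \<in> component l ` V. card A = Suc r}))"
    and "word_mean V t (\<lambda>l. real (card {A \<in> component l ` V. card A = Suc r}))
      \<le> P r * (L r * t ^ r + t ^ Suc r * exp ((real (Suc r))\<^sup>2))"
proof -
  let ?X = "{S. S \<subseteq> V \<and> card S = Suc r}"
  let ?e = "exp (- (t * (2 * real (card V) * real (Suc r) - (real (Suc r))\<^sup>2)))"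
  let ?W = "\<lambda>S. word_sum (S \<times> S) t (\<lambda>l. of_bool (component l ` S = {S}))"
  have eq: "word_mean V t (\<lambda>l. real (card {A \<in> component l ` V. card A = Suc r})) = (\<Sum>S\<in>?X. ?e * ?W S)"
    using word_mean_components_of_size[OF V, of "Suc r" t] by simp
  have cX: "card ?X = card V choose Suc r" using V by (simp add: n_subsets)
  have b: "L r * t ^ r \<le> ?W S" "?W S \<le> L r * t ^ r + t ^ Suc r * exp ((real (Suc r))\<^sup>2)"
    if "S \<in> ?X" for S
    using that V t connected_word_sum_bounds[of S r t] finite_subset[of S V]
    unfolding L_def by blast+
  have "(\<Sum>S\<in>?X. ?e * (L r * t ^ r)) \<le> (\<Sum>S\<in>?X. ?e * ?W S)"
    by (intro sum_mono mult_left_mono b) auto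
  then show "P r * (L r * t ^ r) \<le> word_mean V t (\<lambda>l. real (card {A \<in> component l ` V. card A = Suc r}))"
    unfolding eq P_def sum_constant cX by (simp only: mult.assoc)
  have "(\<Sum>S\<in>?X. ?e * ?W S)
      \<le> (\<Sum>S\<in>?X. ?e * (L r * t ^ r + t ^ Suc r * exp ((real (Suc r))\<^sup>2)))"
    by (intro sum_mono mult_left_mono b) auto
  then show "word_mean V t (\<lambda>l. real (card {A \<in> component l ` V. card A = Suc r}))
      \<le> P r * (L r * t ^ r + t ^ Suc r * exp ((real (Suc r))\<^sup>2))"
    unfolding eq P_def sum_constant cX by (simp only: mult.assoc)
qed

section \<open>The limiting density of orbits\<close>

lemma binomial_over_power_tendsto:
  "(\<lambda>n. real (n choose k) / real n ^ k) \<longlonglongrightarrow> 1 / fact k"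
proof -
  have "(\<lambda>n. (\<Prod>i<k. 1 - real i / real n) / fact k) \<longlonglongrightarrow> (\<Prod>i<k. 1 - 0) / fact k"
    by (intro tendsto_intros tendsto_prod lim_const_over_n) simp
  moreover have "eventually (\<lambda>n. (\<Prod>i<k. 1 - real i / real n) / fact k
      = real (n choose k) / real n ^ k) sequentially"
    using eventually_ge_at_top[of "max 1 k"]
  proof eventually_elim
    case (elim n)
    have "(\<Prod>i<k. 1 - real i / real n) = (\<Prod>i<k. (real n - real i) / real n)"
      using elim by (intro prod.cong) (auto simp: field_simps)
    also have "\<dots> = (\<Prod>i<k. real n - real i) / real n ^ k"
      by (simp add: prod_dividef)
    also have "(\<Prod>i<k. real n - real i) = real (n choose k) * fact k"
      by (simp add: binomial_gbinomial gbinomial_prod_rev atLeast0LessThan)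
    finally show ?case by simp
  qed
  ultimately show ?thesis by (simp add: filterlim_cong)
qed

text \<open>The limiting number per vertex of components with k = r + 1 vertices and r edges. It is
  1/k times the Borel weight exp(-ck) (ck)^(k-1) / k!, the probability that a Poisson(c) branching
  process has total progeny k.\<close>

definition tree_component_density :: "real \<Rightarrow> nat \<Rightarrow> real" where
  "tree_component_density c r =
     real (Suc r) ^ r / real (Suc r) / fact (Suc r) * c ^ r * exp (- c) ^ Suc r"

lemma components_of_size_tendsto:
  assumes c: "c > 0"
  shows "(\<lambda>n. word_mean {1..n} (c / (2 * real n))
      (\<lambda>l. real (card {A \<in> component l ` {1..n}. card A = Suc r})) / real n)
    \<longlonglongrightarrow> tree_component_density c r"
proof -
  define L where "L = (2 * real (Suc r)) ^ r / real (Suc r)"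
  define k where "k = real (Suc r)"
  define b where "b = (\<lambda>n. real (n choose Suc r) / real n ^ Suc r)"
  define x where "x = (\<lambda>n :: nat. exp (- (c * k) + c * k\<^sup>2 / 2 / real n))"
  \<comment> \<open>The lower and upper bounds for the mean, divided by n, at t = c/(2n). The powers
    of n in the binomial coefficient cancel against \<open>t ^ r / n\<close>, and the longer words
    retain a factor 1/n. In the limit the factor \<open>2 ^ r\<close> of \<open>L\<close> cancels
    against \<open>(c / 2) ^ r\<close>.\<close>
  define u where "u = (\<lambda>n. b n * x n * (L * (c / 2) ^ r))"
  define v where "v = (\<lambda>n. b n * x n * (L * (c / 2) ^ r + (c / 2) ^ Suc r * exp (k\<^sup>2) / real n))"
  have b: "b \<longlonglongrightarrow> 1 / fact (Suc r)"
    unfolding b_def by (rule binomial_over_power_tendsto)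
  have x: "x \<longlonglongrightarrow> exp (- (c * k) + 0)"
    unfolding x_def by (intro tendsto_intros lim_const_over_n)
  have lim: "1 / fact (Suc r) * exp (- (c * k) + 0) * (L * (c / 2) ^ r) = tree_component_density c r"
    by (simp only: tree_component_density_def L_def k_def exp_of_nat_mult[symmetric] power_mult_distrib)
      (simp add: power_divide mult_ac)
  have u: "u \<longlonglongrightarrow> tree_component_density c r"
    unfolding u_def lim[symmetric] by (intro tendsto_intros b x)
  have "v \<longlonglongrightarrow> 1 / fact (Suc r) * exp (- (c * k) + 0) * (L * (c / 2) ^ r + 0)"
    unfolding v_def by (intro tendsto_intros b x lim_const_over_n)
  then have v: "v \<longlonglongrightarrow> tree_component_density c r" using lim by simp
  have "eventually (\<lambda>n :: nat. 1 \<le> n \<and> c \<le> real n) sequentially"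
    by (intro eventually_conj eventually_ge_at_top)
      (metis eventually_at_top_linorder nat_ceiling_le_eq)
  then have ev: "eventually (\<lambda>n. u n \<le> word_mean {1..n} (c / (2 * real n))
        (\<lambda>l. real (card {A \<in> component l ` {1..n}. card A = Suc r})) / real n \<and>
      word_mean {1..n} (c / (2 * real n))
        (\<lambda>l. real (card {A \<in> component l ` {1..n}. card A = Suc r})) / real n \<le> v n) sequentially"
  proof eventually_elim
    case (elim n)
    let ?t = "c / (2 * real n)"
    let ?W = "word_mean {1..n} ?t (\<lambda>l. real (card {A \<in> component l ` {1..n}. card A = Suc r}))"
    have n: "real n > 0" using elim by simp
    have t: "0 \<le> ?t" "?t \<le> 1" using elim c by (auto simp: field_simps)
    have t1: "?t = c / 2 / real n" by simp
    have e: "exp (- (?t * (2 * real n * real (Suc r) - (real (Suc r))\<^sup>2))) = x n"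
      using n unfolding x_def k_def by (intro arg_cong[where f = exp]) (simp add: field_simps)
    note bd = word_mean_components_of_size_bounds[of "{1..n}" ?t r, OF _ t, unfolded card_atLeastAtMost,
      simplified diff_Suc_1 e, folded L_def k_def]
    have pw: "?t ^ r / real n = (c / 2) ^ r / real n ^ Suc r"
      unfolding t1 using n by (simp add: power_divide)
    have "u n = real (n choose Suc r) * x n * (L * ?t ^ r) / real n"
      unfolding u_def b_def t1 using n by (simp add: power_divide)
    moreover have "v n = real (n choose Suc r) * x n * (L * ?t ^ r + ?t ^ Suc r * exp (k\<^sup>2)) / real n"
      unfolding v_def b_def t1 using n by (simp add: power_divide field_simps)
    ultimately show ?case using bd n by (simp add: divide_right_mono)
  qed
  show ?thesis
    by (rule tendsto_sandwich[OF _ _ u v]) (use ev in \<open>auto elim: eventually_mono\<close>)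
qed

section \<open>From components of bounded size to all orbits\<close>

lemma card_filter_image_le:
  "finite V \<Longrightarrow> card {A \<in> f ` V. P A} \<le> card V"
  by (rule order.trans[OF card_mono[of "f ` V"] card_image_le]) auto

lemma card_components_by_size:
  assumes "finite V" "set l \<subseteq> V \<times> V"
  shows "card (component l ` V) = (\<Sum>r<R. card {A \<in> component l ` V. card A = Suc r})
    + card {A \<in> component l ` V. R < card A}"
proof (induction R)
  case 0
  have "0 < card (component l x)" if "x \<in> V" for x
    unfolding card_gt_0_iff
    using component_subset[OF assms(2) that] component_self[of x l] assms(1) finite_subset by blast
  then have "{A \<in> component l ` V. 0 < card A} = component l ` V" by auto
  then show ?case by simp
next
  case (Suc R)
  have "{A \<in> component l ` V. R < card A} = {A \<in> component l ` V. card A = Suc R}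
      \<union> {A \<in> component l ` V. Suc R < card A}" by auto
  then have "card {A \<in> component l ` V. R < card A} = card {A \<in> component l ` V. card A = Suc R}
      + card {A \<in> component l ` V. Suc R < card A}"
    using assms(1) by (simp only:) (intro card_Un_disjoint; auto)
  then show ?case using Suc by simp
qed

text \<open>Each letter costs at most 2K/n, and the Poissonian word has mean length t n^2, which is
  the series of m x^m / m! evaluated at x = t n^2.\<close>

lemma word_mean_small_noncomponents:
  assumes V: "finite V" "card V > 0" and t: "0 \<le> t"
  shows "word_mean V t (\<lambda>l. real (card (small_noncomponents K V l))) \<le> 2 * real K * (t * card V)"
proof -
  let ?n = "real (card V)" and ?d = "\<lambda>l. real (card (small_noncomponents K V l))"
  let ?x = "t * ?n\<^sup>2"
  have fin: "finite (V \<times> V)" using V by simp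
  have bd: "\<bar>?d l\<bar> \<le> ?n" for l
    using card_filter_image_le[OF V(1)] by (simp add: small_noncomponents_def)
  have "(\<lambda>m. ?x * (?x ^ m / fact m)) sums (?x * exp ?x)"
    using exp_converges[of ?x] by (intro sums_mult) (simp add: field_simps)
  also have "(\<lambda>m. ?x * (?x ^ m / fact m)) = (\<lambda>m. real (Suc m) * ?x ^ Suc m / fact (Suc m))"
    by (intro ext) (simp add: field_simps del: of_nat_Suc)
  finally have "(\<lambda>m. real m * ?x ^ m / fact m) sums (?x * exp ?x)"
    by (subst (asm) sums_Suc_iff) simp
  then have sm: "(\<lambda>m. 2 * real K / ?n * (real m * ?x ^ m / fact m)) sums (2 * real K / ?n * (?x * exp ?x))"
    by (rule sums_mult)
  have le: "t ^ m * (\<Sum>l\<in>words (V \<times> V) m. ?d l) / fact m \<le> 2 * real K / ?n * (real m * ?x ^ m / fact m)" for m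
  proof -
    have "?n * (\<Sum>l\<in>words (V \<times> V) m. ?d l) \<le> 2 * real K * real m * (?n\<^sup>2) ^ m"
      using of_nat_mono[OF sum_card_small_noncomponents[OF V(1), of K m], where 'a = real] by simp
    then have "(\<Sum>l\<in>words (V \<times> V) m. ?d l) \<le> 2 * real K * real m * (?n\<^sup>2) ^ m / ?n"
      using V by (simp add: field_simps)
    then have "t ^ m * (\<Sum>l\<in>words (V \<times> V) m. ?d l) / fact m
        \<le> t ^ m * (2 * real K * real m * (?n\<^sup>2) ^ m / ?n) / fact m"
      using t by (intro divide_right_mono mult_left_mono) auto
    then show ?thesis by (simp add: power_mult_distrib mult_ac)
  qed
  have "word_sum (V \<times> V) t ?d \<le> (\<Sum>m. 2 * real K / ?n * (real m * ?x ^ m / fact m))"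
    unfolding word_sum_def
    by (rule suminf_le[OF le summable_word_sum[OF fin bd] sums_summable[OF sm]])
  also have "\<dots> = 2 * real K / ?n * (?x * exp ?x)" using sm by (rule sums_unique[symmetric])
  also have "\<dots> = 2 * real K * (t * ?n) * exp ?x"
    using V by (simp add: power2_eq_square)
  finally have "exp (- ?x) * word_sum (V \<times> V) t ?d \<le> exp (- ?x) * (2 * real K * (t * ?n) * exp ?x)"
    by (intro mult_left_mono) auto
  also have "\<dots> = 2 * real K * (t * ?n)" by (simp add: exp_minus)
  finally show ?thesis by (simp add: word_mean_def)
qed

lemma word_mean_orbits_ge:
  fixes V :: "'a set" and R :: nat
  assumes V: "finite V" and t: "0 \<le> t"
  shows "(\<Sum>r<R. word_mean V t (\<lambda>l. real (card {A \<in> component l ` V. card A = Suc r})))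
    \<le> word_mean V t (\<lambda>l. real (card (orbit (transposition_prod l) ` V)))"
proof -
  have b: "real (card {A \<in> component l ` V. card A = Suc r}) \<le> card V" for l :: "('a \<times> 'a) list" and r
    using card_filter_image_le[OF V] by simp
  have "(\<Sum>r<R. word_mean V t (\<lambda>l. real (card {A \<in> component l ` V. card A = Suc r})))
      = word_mean V t (\<lambda>l. \<Sum>r<R. real (card {A \<in> component l ` V. card A = Suc r}))"
    using b by (intro word_mean_sum[symmetric, where C = "\<lambda>_. real (card V)"] V) auto
  also have "\<dots> \<le> word_mean V t (\<lambda>l. real (card (orbit (transposition_prod l) ` V)))"
  proof (rule word_mean_mono[where C = "real (card V)"])
    fix l :: "('a \<times> 'a) list" assume l: "set l \<subseteq> V \<times> V"
    have "(\<Sum>r<R. card {A \<in> component l ` V. card A = Suc r}) \<le> card (component l ` V)"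
      using card_components_by_size[OF V l, of R] by linarith
    also have "\<dots> \<le> card (orbit (transposition_prod l) ` V)"
      by (rule card_components_le_card_orbits[OF V])
    finally have le: "(\<Sum>r<R. card {A \<in> component l ` V. card A = Suc r})
      \<le> card (orbit (transposition_prod l) ` V)" .
    have le': "card (orbit (transposition_prod l) ` V) \<le> card V" by (rule card_image_le[OF V])
    show "(\<Sum>r<R. real (card {A \<in> component l ` V. card A = Suc r}))
        \<le> real (card (orbit (transposition_prod l) ` V))"
      unfolding of_nat_sum[symmetric] using le by (rule of_nat_mono)
    show "\<bar>\<Sum>r<R. real (card {A \<in> component l ` V. card A = Suc r})\<bar> \<le> real (card V)"
      unfolding of_nat_sum[symmetric] using order.trans[OF le le'] by (simp only: abs_of_nat of_nat_le_iff)
    show "\<bar>real (card (orbit (transposition_prod l) ` V))\<bar> \<le> real (card V)" using le' by simp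
  qed (use V t in auto)
  finally show ?thesis .
qed

text \<open>The term 2n/R has two sources: the large orbits, and the large components that the sum
  over sizes up to \<open>R\<close> omits. The last term is the mean number of small orbits that are
  not components.\<close>

lemma word_mean_orbits_le:
  fixes V :: "'a set" and R :: nat
  assumes V: "finite V" "card V > 0" and t: "0 \<le> t" and R: "R > 0"
  shows "word_mean V t (\<lambda>l. real (card (orbit (transposition_prod l) ` V)))
    \<le> (\<Sum>r<R. word_mean V t (\<lambda>l. real (card {A \<in> component l ` V. card A = Suc r})))
      + 2 * real (card V) / R + 2 * real R * (t * card V)"
proof -
  let ?F = "\<lambda>r l. real (card {A \<in> component l ` V. card A = Suc r})"
  let ?D = "\<lambda>l. real (card (small_noncomponents R V l))"
  let ?n = "real (card V)"
  have bF: "\<bar>?F r l\<bar> \<le> ?n" for l r using card_filter_image_le[OF V(1)] by simp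
  have bD: "\<bar>?D l\<bar> \<le> ?n" for l
    using card_filter_image_le[OF V(1)] by (simp add: small_noncomponents_def)
  have bS: "\<bar>\<Sum>r<R. ?F r l\<bar> \<le> real R * ?n" for l
  proof -
    have "\<bar>\<Sum>r<R. ?F r l\<bar> \<le> (\<Sum>r<R. ?n)"
      by (rule order.trans[OF sum_abs sum_mono]) (rule bF)
    then show ?thesis by simp
  qed
  \<comment> \<open>A crude common bound for all functions averaged below, as monotonicity and
    additivity of \<open>word_mean\<close> ask for one.\<close>
  define C where "C = real R * ?n + 2 * ?n / R + ?n"
  have C: "real R * ?n \<le> C" "?n \<le> C" "2 * ?n / R \<le> C" "real R * ?n + 2 * ?n / R \<le> C"
    by (auto simp: C_def)
  have "word_mean V t (\<lambda>l. real (card (orbit (transposition_prod l) ` V)))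
      \<le> word_mean V t (\<lambda>l. ((\<Sum>r<R. ?F r l) + 2 * ?n / R) + ?D l)"
  proof (rule word_mean_mono[where C = "C"])
    fix l :: "('a \<times> 'a) list" assume l: "set l \<subseteq> V \<times> V"
    have "real (card {A \<in> orbit (transposition_prod l) ` V. R < card A}) \<le> ?n / R"
      using card_large_orbits[OF V(1) l, of R] R
      by (simp add: field_simps flip: of_nat_mult)
    moreover have "real (card {A \<in> component l ` V. R < card A}) \<le> ?n / R"
      using card_large_components[OF V(1) l, of R] R
      by (simp add: field_simps flip: of_nat_mult)
    moreover have "real (card (orbit (transposition_prod l) ` V)) \<le> real (card (component l ` V))
        + real (card {A \<in> orbit (transposition_prod l) ` V. R < card A}) + ?D l"
      using card_orbits_le[OF V(1) l, of R] by (simp flip: of_nat_add)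
    moreover have "real (card (component l ` V)) = (\<Sum>r<R. ?F r l)
        + real (card {A \<in> component l ` V. R < card A})"
      using card_components_by_size[OF V(1) l, of R] by simp
    ultimately show "real (card (orbit (transposition_prod l) ` V)) \<le> ((\<Sum>r<R. ?F r l) + 2 * ?n / R) + ?D l"
      by linarith
    show "\<bar>((\<Sum>r<R. ?F r l) + 2 * ?n / R) + ?D l\<bar> \<le> C"
      using bS[of l] bD[of l] divide_nonneg_nonneg[of "2 * ?n" "real R"] unfolding C_def by linarith
    show "\<bar>real (card (orbit (transposition_prod l) ` V))\<bar> \<le> C"
      using card_image_le[OF V(1), of "orbit (transposition_prod l)"] C(2) by simp
  qed (use V t in auto)
  also have "\<dots> = word_mean V t (\<lambda>l. (\<Sum>r<R. ?F r l) + 2 * ?n / R) + word_mean V t ?D"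
  proof (rule word_mean_add[where C = C])
    show "\<bar>(\<Sum>r<R. ?F r l) + 2 * ?n / R\<bar> \<le> C" for l
      using bS[of l] divide_nonneg_nonneg[of "2 * ?n" "real R"] unfolding C_def by linarith
    show "\<bar>?D l\<bar> \<le> C" for l using bD[of l] C(2) by linarith
  qed (use V in auto)
  also have "word_mean V t (\<lambda>l. (\<Sum>r<R. ?F r l) + 2 * ?n / R)
      = word_mean V t (\<lambda>l. \<Sum>r<R. ?F r l) + word_mean V t (\<lambda>l. 2 * ?n / R)"
  proof (rule word_mean_add[where C = C])
    show "\<bar>\<Sum>r<R. ?F r l\<bar> \<le> C" for l using bS[of l] C(1) by linarith
    show "\<bar>2 * ?n / R\<bar> \<le> C" using C(3) by simp
  qed (use V in auto)
  also have "word_mean V t (\<lambda>l. \<Sum>r<R. ?F r l) = (\<Sum>r<R. word_mean V t (?F r))"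
    using bF by (intro word_mean_sum[where C = "\<lambda>_. ?n"] V) auto
  also have "word_mean V t (\<lambda>l. 2 * ?n / R) = 2 * ?n / R" by (rule word_mean_const[OF V(1)])
  finally show ?thesis using word_mean_small_noncomponents[OF V t, of R] by linarith
qed

text \<open>The lower bound together with \<open>x n \<le> 1\<close> bounds the partial sums of
  \<open>g\<close>, hence summability. The upper bound takes the place of uniform control of the
  tails: \<open>R\<close> is chosen first, making the tail of \<open>g\<close> and
  \<open>2 / R\<close> small, and then \<open>n\<close> grows with \<open>R\<close> fixed. Four
  errors below \<open>e / 4\<close> arise.\<close>

lemma tendsto_suminf_of_truncations:
  fixes x :: "nat \<Rightarrow> real" and a :: "nat \<Rightarrow> nat \<Rightarrow> real"
  assumes lower: "\<And>n R. n > 0 \<Longrightarrow> (\<Sum>r<R. a r n) \<le> x n"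
    and upper: "\<And>n R. n > 0 \<Longrightarrow> R > 0 \<Longrightarrow> x n \<le> (\<Sum>r<R. a r n) + 2 / real R + c * real R / real n"
    and x1: "\<And>n. n > 0 \<Longrightarrow> x n \<le> 1"
    and lim: "\<And>r. a r \<longlonglongrightarrow> g r" and g0: "\<And>r. 0 \<le> g r"
  shows "summable g" and "x \<longlonglongrightarrow> suminf g"
proof -
  have limS: "(\<lambda>n. \<Sum>r<R. a r n) \<longlonglongrightarrow> (\<Sum>r<R. g r)" for R
    by (intro tendsto_sum lim)
  have "(\<Sum>r<R. g r) \<le> 1" for R
    using order.trans[OF lower x1]
    by (intro LIMSEQ_le_const2[OF limS]) (auto intro!: exI[of _ 1])
  then show sm: "summable g" using g0 by (intro summableI_nonneg_bounded[where x = 1]) auto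
  show "x \<longlonglongrightarrow> suminf g"
  proof (rule LIMSEQ_I)
    fix e :: real assume e: "0 < e"
    have "eventually (\<lambda>R. dist (\<Sum>r<R. g r) (suminf g) < e / 4) sequentially"
      using summable_LIMSEQ[OF sm] e by (intro tendstoD) auto
    moreover have "eventually (\<lambda>R. dist (2 / real R) 0 < e / 4) sequentially"
      using e by (intro tendstoD lim_const_over_n) auto
    ultimately have "eventually (\<lambda>R. dist (\<Sum>r<R. g r) (suminf g) < e / 4 \<and> dist (2 / real R) 0 < e / 4
        \<and> 0 < R) sequentially"
      by (intro eventually_conj eventually_gt_at_top)
    then obtain R where R: "dist (\<Sum>r<R. g r) (suminf g) < e / 4" "2 / real R < e / 4" "0 < R"
      by (auto simp: eventually_at_top_linorder)
    have "eventually (\<lambda>n. dist (\<Sum>r<R. a r n) (\<Sum>r<R. g r) < e / 4) sequentially"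
      using limS e by (intro tendstoD) auto
    moreover have "eventually (\<lambda>n. dist (c * real R / real n) 0 < e / 4) sequentially"
      using e by (intro tendstoD lim_const_over_n) auto
    ultimately have "eventually (\<lambda>n. norm (x n - suminf g) < e) sequentially"
      using eventually_gt_at_top[of 0]
    proof eventually_elim
      case (elim n)
      then show ?case using R lower[of n R] upper[of n R] unfolding dist_real_def real_norm_def by linarith
    qed
    then show "\<exists>n0. \<forall>n\<ge>n0. norm (x n - suminf g) < e" by (simp add: eventually_at_top_linorder)
  qed
qed

lemma word_mean_orbits_tendsto:
  assumes c: "c > 0"
  shows "summable (tree_component_density c)"
    and "(\<lambda>n. word_mean {1..n} (c / (2 * real n))
        (\<lambda>l. real (card (orbit (transposition_prod l) ` {1..n}))) / real n)
      \<longlonglongrightarrow> suminf (tree_component_density c)"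
proof -
  let ?a = "\<lambda>r n. word_mean {1..n} (c / (2 * real n))
    (\<lambda>l. real (card {A \<in> component l ` {1..n}. card A = Suc r})) / real n"
  let ?x = "\<lambda>n. word_mean {1..n} (c / (2 * real n))
    (\<lambda>l. real (card (orbit (transposition_prod l) ` {1..n}))) / real n"
  have lower: "(\<Sum>r<R. ?a r n) \<le> ?x n" if "n > 0" for n R
    unfolding sum_divide_distrib[symmetric]
    using c by (intro divide_right_mono word_mean_orbits_ge) auto
  have upper: "?x n \<le> (\<Sum>r<R. ?a r n) + 2 / real R + c * real R / real n" if "n > 0" "R > 0" for n R
  proof -
    let ?t = "c / (2 * real n)"
    have "?x n \<le> ((\<Sum>r<R. word_mean {1..n} ?t (\<lambda>l. real (card {A \<in> component l ` {1..n}. card A = Suc r})))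
        + 2 * real (card {1..n}) / R + 2 * real R * (?t * card {1..n})) / real n"
      using that c by (intro divide_right_mono word_mean_orbits_le) auto
    also have "\<dots> = (\<Sum>r<R. ?a r n) + 2 / real R + c * real R / real n"
      using that unfolding sum_divide_distrib[symmetric] by (simp add: add_divide_distrib)
    finally show ?thesis .
  qed
  have one: "?x n \<le> 1" if "n > 0" for n
  proof -
    have le: "card (orbit (transposition_prod l) ` {1..n}) \<le> n" for l
      using card_image_le[of "{1..n}"] by simp
    have "word_mean {1..n} (c / (2 * real n)) (\<lambda>l. real (card (orbit (transposition_prod l) ` {1..n})))
        \<le> word_mean {1..n} (c / (2 * real n)) (\<lambda>_. real n)"
      using c le by (intro word_mean_mono[where C = "real n"]) auto
    then show ?thesis using that by (simp add: word_mean_const)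
  qed
  have nonneg: "0 \<le> tree_component_density c r" for r
    using c by (simp add: tree_component_density_def)
  show "summable (tree_component_density c)"
    by (rule tendsto_suminf_of_truncations(1)[of ?a ?x c, OF lower upper one components_of_size_tendsto[OF c] nonneg])
  show "?x \<longlonglongrightarrow> suminf (tree_component_density c)"
    by (rule tendsto_suminf_of_truncations(2)[of ?a ?x c, OF lower upper one components_of_size_tendsto[OF c] nonneg])
qed

text \<open>The index shift is k = r + 1. At k = 1 the exponent k - 2 is negative, whence
  \<open>powi\<close> on one side and \<open>real (Suc r) ^ r / real (Suc r)\<close> on the other.
  The terms are nonnegative, so the unordered and the ordinary sum agree.\<close>

lemma distance_limit_eq:
  assumes c: "c > 0"
  shows "distance_limit c = 1 - suminf (tree_component_density c)"
proof -
  let ?h = "\<lambda>k. real k powi (int k - 2) / fact k * (1 / c) * (c * exp (- c)) ^ k"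
  have eq: "?h (Suc r) = tree_component_density c r" for r
  proof -
    have "real (Suc r) powi (int (Suc r) - 2) = real (Suc r) powi (int r - 1)"
      by (intro arg_cong2[where f = power_int]) auto
    also have "\<dots> = real (Suc r) ^ r / real (Suc r)"
      by (subst power_int_diff) auto
    finally show ?thesis
      using c by (simp only: tree_component_density_def power_mult_distrib) simp
  qed
  have nonneg: "0 \<le> tree_component_density c r" for r
    using c by (simp add: tree_component_density_def)
  have "infsum ?h {1..} = infsum (tree_component_density c) UNIV"
    by (rule infsum_reindex_bij_witness[of _ "\<lambda>r. Suc r" "\<lambda>k. k - 1"])
      (auto simp del: power_Suc fact_Suc simp flip: eq)
  also have "\<dots> = suminf (tree_component_density c)"
    using nonneg word_mean_orbits_tendsto(1)[OF c]
    by (intro infsumI norm_summable_imp_has_sum summable_sums) (simp_all add: abs_of_nonneg)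
  finally show ?thesis by (simp add: distance_limit_def)
qed

section \<open>The transposition length of the interchange process\<close>

lemma untouched_orbits_transpose_subset:
  assumes p: "permutation p"
  shows "{A \<in> orbit p ` V. i \<notin> A \<and> j \<notin> A}
    \<subseteq> {A \<in> orbit (Transposition.transpose i j \<circ> p) ` V. i \<notin> A \<and> j \<notin> A}"
  using orbit_transpose_other[OF p, of i _ j] by (auto simp: image_iff)

lemma untouched_orbits_transpose:
  assumes p: "permutation p"
  shows "{A \<in> orbit (Transposition.transpose i j \<circ> p) ` V. i \<notin> A \<and> j \<notin> A}
    = {A \<in> orbit p ` V. i \<notin> A \<and> j \<notin> A}"
  using untouched_orbits_transpose_subset[OF p, of V i j]
    untouched_orbits_transpose_subset[OF permutation_transpose_comp[OF p, of i j], of V i j]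
  unfolding transpose_comp_transpose_comp by (rule equalityI[rotated])

text \<open>Orbits avoiding \<open>i\<close> and \<open>j\<close> are common to \<open>p\<close> and
  its composition with the transposition, so the two orbit counts differ only in the last
  summand.\<close>

lemma card_orbits_eq:
  assumes p: "permutation p" and V: "finite V" "i \<in> V" "j \<in> V"
  shows "card (orbit p ` V) = card {A \<in> orbit p ` V. i \<notin> A \<and> j \<notin> A}
    + (if j \<in> orbit p i then 1 else 2)"
proof -
  let ?F = "{A \<in> orbit p ` V. i \<notin> A \<and> j \<notin> A}"
  have self: "i \<in> orbit p i" "j \<in> orbit p j" using p by (auto intro: permutation_self_in_orbit)
  have "orbit p ` V = insert (orbit p i) (insert (orbit p j) ?F)"
    using V orbit_eq_permutation[OF p] by auto
  then have "card (orbit p ` V) = card (insert (orbit p i) (insert (orbit p j) ?F))"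
    by (rule arg_cong)
  moreover have "finite ?F" using V by simp
  moreover have "orbit p i \<notin> ?F" "orbit p j \<notin> ?F" using self by auto
  moreover have "orbit p i = orbit p j \<longleftrightarrow> j \<in> orbit p i"
    using self orbit_eq_permutation[OF p] by metis
  ultimately show ?thesis by (simp add: card_insert_if)
qed

lemma card_orbits_transpose_ge:
  assumes "permutation p" "finite V" "i \<in> V" "j \<in> V"
  shows "card (orbit p ` V) \<le> Suc (card (orbit (Transposition.transpose i j \<circ> p) ` V))"
  using card_orbits_eq[OF assms] card_orbits_eq[OF permutation_transpose_comp[OF assms(1)] assms(2-4)]
    untouched_orbits_transpose[OF assms(1)]
  by (simp split: if_splits)

lemma card_orbits_transpose_split:
  assumes "permutation p" "finite V" "i \<in> V" "j \<in> V" "i \<noteq> j" "j \<in> orbit p i"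
  shows "card (orbit (Transposition.transpose i j \<circ> p) ` V) = Suc (card (orbit p ` V))"
  unfolding card_orbits_eq[OF assms(1-4)]
    card_orbits_eq[OF permutation_transpose_comp[OF assms(1)] assms(2-4)]
    untouched_orbits_transpose[OF assms(1)]
  using orbit_transpose_split(3)[OF assms(1,6,5)] assms(6) by simp

lemma foldr_comp_Nil: "foldr (\<circ>) [] id = id"
  by (rule ext) simp

lemma foldr_comp_Cons: "foldr (\<circ>) (\<tau> # ts) id = \<tau> \<circ> foldr (\<circ>) ts id"
  by (rule ext) simp

text \<open>The identity has \<open>n\<close> orbits on \<open>{1..n}\<close>, fixed points
  included, and each transposition removes at most one. This is the lower bound on the
  length.\<close>

lemma transpositions_prod_orbits:
  assumes "set ts \<subseteq> transpositions n"
  shows "foldr (\<circ>) ts id permutes {1..n}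
    \<and> n \<le> card (orbit (foldr (\<circ>) ts id) ` {1..n}) + length ts"
  using assms
proof (induction ts)
  case Nil
  have "orbit id x = {x}" for x :: nat by (simp add: orbit_eq_singleton_iff)
  then have "orbit id ` {1..n} = (\<lambda>x. {x}) ` {1..n}" by (intro image_cong) auto
  then have "card (orbit id ` {1..n}) = n" by (simp add: card_image)
  then show ?case unfolding foldr_comp_Nil using permutes_id by (metis le_add1)
next
  case (Cons \<tau> ts)
  then obtain i j where ij: "\<tau> = Transposition.transpose i j" "i \<in> {1..n}" "j \<in> {1..n}"
    by (force simp: transpositions_def)
  let ?p = "foldr (\<circ>) ts id"
  have p: "?p permutes {1..n}" and le: "n \<le> card (orbit ?p ` {1..n}) + length ts"
    using Cons.IH Cons.prems by (metis insert_subset list.simps(15))+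
  have "permutation ?p" using p by (auto simp: permutation_permutes)
  from card_orbits_transpose_ge[OF this _ ij(2,3)]
  have "card (orbit ?p ` {1..n}) \<le> Suc (card (orbit (foldr (\<circ>) (\<tau> # ts) id) ` {1..n}))"
    unfolding foldr_comp_Cons ij by simp
  moreover have "foldr (\<circ>) (\<tau> # ts) id permutes {1..n}"
    unfolding ij foldr_comp_Cons by (rule permutes_compose[OF p permutes_swap_id[OF ij(2,3)]])
  ultimately show ?case using le unfolding list.size(4) by (intro conjI) (assumption, linarith)
qed

text \<open>Composing \<open>p\<close> with the transposition of \<open>i\<close> and
  \<open>p i\<close> makes \<open>i\<close> a fixed point, which splits its cycle and adds one
  orbit. Repeating this with a moved point each time ends at the identity after as many steps as
  orbits were missing.\<close>

lemma ex_transpositions_prod: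
  assumes "p permutes {1..n}"
  shows "\<exists>ts. length ts = n - card (orbit p ` {1..n}) \<and> set ts \<subseteq> transpositions n \<and> p = foldr (\<circ>) ts id"
  using assms
proof (induction "n - card (orbit p ` {1..n})" arbitrary: p rule: less_induct)
  case less
  let ?V = "{1..n}"
  have le: "card (orbit q ` ?V) \<le> n" for q :: "nat \<Rightarrow> nat" using card_image_le[of ?V "orbit q"] by simp
  have p: "permutation p" using less.prems by (auto simp: permutation_permutes)
  show ?case
  proof (cases "p = id")
    case True
    have "n - card (orbit p ` ?V) = 0"
      using transpositions_prod_orbits[of "[]" n] True unfolding foldr_comp_Nil by simp
    then have "length [] = n - card (orbit p ` ?V)" by (simp only: list.size(3))
    moreover have "p = foldr (\<circ>) [] id" unfolding foldr_comp_Nil by (rule True)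
    ultimately show ?thesis by (metis empty_subsetI list.set(1))
  next
    case False
    then obtain i where i: "p i \<noteq> i" by (auto simp: fun_eq_iff)
    let ?j = "p i"
    let ?q = "Transposition.transpose i ?j \<circ> p"
    have V: "i \<in> ?V" "?j \<in> ?V" using less.prems i permutes_not_in permutes_in_image by metis+
    have c: "card (orbit ?q ` ?V) = Suc (card (orbit p ` ?V))"
      using i by (intro card_orbits_transpose_split[OF p _ V]) (auto intro: orbit.base)
    have q: "?q permutes ?V" by (rule permutes_compose[OF less.prems permutes_swap_id[OF V]])
    have "n - card (orbit ?q ` ?V) < n - card (orbit p ` ?V)" using c le[of ?q] by linarith
    from less.hyps[OF this q] obtain ts where
      ts: "length ts = n - card (orbit ?q ` ?V)" "set ts \<subseteq> transpositions n" "?q = foldr (\<circ>) ts id"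
      by blast
    have "Transposition.transpose i ?j \<in> transpositions n"
    proof (cases "i < ?j")
      case True then show ?thesis using V unfolding transpositions_def by auto
    next
      case False
      then have "Transposition.transpose i ?j = Transposition.transpose ?j i" "?j < i"
        using i by (auto simp: transpose_commute)
      then show ?thesis using V unfolding transpositions_def by auto
    qed
    moreover have "p = foldr (\<circ>) (Transposition.transpose i ?j # ts) id"
      unfolding foldr_comp_Cons ts(3)[symmetric] by (rule transpose_comp_transpose_comp[symmetric])
    moreover have "length (Transposition.transpose i ?j # ts) = n - card (orbit p ` ?V)"
      using ts(1) c le[of ?q] by simp
    ultimately show ?thesis using ts(2) by (metis insert_subset list.simps(15))
  qed
qed

lemma transposition_length_eq:
  assumes "p \<in> sym_grp n"
  shows "transposition_length n p = n - card (orbit p ` {1..n})"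
  unfolding transposition_length_def
proof (rule Least_equality)
  show "\<exists>ts. length ts = n - card (orbit p ` {1..n}) \<and> set ts \<subseteq> transpositions n \<and> p = foldr (\<circ>) ts id"
    using assms by (intro ex_transpositions_prod) (simp add: sym_grp_def)
next
  fix k assume "\<exists>ts. length ts = k \<and> set ts \<subseteq> transpositions n \<and> p = foldr (\<circ>) ts id"
  then show "n - card (orbit p ` {1..n}) \<le> k" using transpositions_prod_orbits by fastforce
qed

section \<open>The exponential of the generator as a Poissonian mean\<close>

lemma interchange_generator_eq:
  fixes n :: nat
  defines "V \<equiv> {1..n}"
  shows "2 * interchange_generator n s
    = (\<Sum>(i, j)\<in>V \<times> V. galg_basis (Transposition.transpose i j) s) - (of_nat n)\<^sup>2 * galg_basis id s"
proof -
  define g where "g = (\<lambda>(i, j). galg_basis (Transposition.transpose i j) s - galg_basis id s)"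
  let ?U = "{(i, j). 1 \<le> i \<and> i < j \<and> j \<le> n}" and ?D = "(\<lambda>i. (i, i)) ` V"
  have finU: "finite ?U" by (rule finite_subset[of _ "V \<times> V"]) (auto simp: V_def)
  have finD: "finite ?D" by (simp add: V_def)
  \<comment> \<open>Each unordered pair occurs in both orders, hence the factor 2, and the diagonal
    contributes 0 because \<open>transpose i i\<close> is the identity.\<close>
  have split: "V \<times> V = (?U \<union> prod.swap ` ?U) \<union> ?D" by (force simp: V_def)
  have "(\<Sum>e\<in>V \<times> V. g e) = (\<Sum>e\<in>?U \<union> prod.swap ` ?U. g e) + (\<Sum>e\<in>?D. g e)"
    unfolding split using finU finD by (intro sum.union_disjoint) auto
  also have "(\<Sum>e\<in>?U \<union> prod.swap ` ?U. g e) = (\<Sum>e\<in>?U. g e) + (\<Sum>e\<in>prod.swap ` ?U. g e)"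
    using finU by (intro sum.union_disjoint) auto
  also have "(\<Sum>e\<in>prod.swap ` ?U. g e) = (\<Sum>e\<in>?U. g (prod.swap e))"
    by (subst sum.reindex) (auto simp: o_def)
  also have "(\<Sum>e\<in>?U. g (prod.swap e)) = (\<Sum>e\<in>?U. g e)"
    by (intro sum.cong refl) (auto simp: g_def transpose_commute)
  also have "(\<Sum>e\<in>?D. g e) = 0" by (intro sum.neutral) (auto simp: g_def)
  also have "(\<Sum>e\<in>?U. g e) = interchange_generator n s"
    by (simp add: interchange_generator_def g_def)
  finally have "2 * interchange_generator n s = (\<Sum>e\<in>V \<times> V. g e)" by simp
  also have "\<dots> = (\<Sum>(i, j)\<in>V \<times> V. galg_basis (Transposition.transpose i j) s) - (\<Sum>e\<in>V \<times> V. galg_basis id s)"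
    by (simp add: g_def case_prod_unfold sum_subtractf)
  also have "(\<Sum>e\<in>V \<times> V. galg_basis id s) = (of_nat n)\<^sup>2 * galg_basis id s"
    by (simp add: V_def card_cartesian_product power2_eq_square)
  finally show ?thesis .
qed

lemma transpose_in_sym_grp: "i \<in> {1..n} \<Longrightarrow> j \<in> {1..n} \<Longrightarrow> Transposition.transpose i j \<in> sym_grp n"
  by (simp add: sym_grp_def permutes_swap_id)

lemma comp_in_sym_grp: "p \<in> sym_grp n \<Longrightarrow> q \<in> sym_grp n \<Longrightarrow> p \<circ> q \<in> sym_grp n"
  by (simp add: sym_grp_def permutes_compose)

lemma id_in_sym_grp: "id \<in> sym_grp n"
  using permutes_id by (simp add: sym_grp_def)

lemma galg_mult_sum_left:
  "galg_mult n (\<lambda>s. \<Sum>e\<in>E. f e s) g s = (\<Sum>e\<in>E. galg_mult n (f e) g s)"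
proof -
  have "(if u \<circ> v = s then (\<Sum>e\<in>E. f e u) * g v else 0)
      = (\<Sum>e\<in>E. if u \<circ> v = s then f e u * g v else 0)" for u v
    by (simp add: sum_distrib_right)
  then show ?thesis
    unfolding galg_mult_def by (simp only: sum.swap[of _ E "sym_grp n"])
qed

lemma galg_mult_diff_left:
  "galg_mult n (\<lambda>s. f s - f' s) g s = galg_mult n f g s - galg_mult n f' g s"
  unfolding galg_mult_def sum_subtractf[symmetric]
  by (intro sum.cong refl) (simp add: left_diff_distrib)

lemma galg_mult_cmult_left: "galg_mult n (\<lambda>s. a * f s) g s = a * galg_mult n f g s"
  unfolding galg_mult_def sum_distrib_left by (intro sum.cong refl) simp

text \<open>For an involution \<open>u\<close> the equation \<open>u \<circ> v = s\<close> has the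
  single solution \<open>v = u \<circ> s\<close>; transpositions and the identity are the cases of
  interest.\<close>

lemma galg_mult_basis_left:
  assumes u: "u \<in> sym_grp n" "u \<circ> u = id" and s: "s \<in> sym_grp n"
  shows "galg_mult n (galg_basis u) g s = g (u \<circ> s)"
proof -
  have iff: "u \<circ> v = s \<longleftrightarrow> v = u \<circ> s" for v using u(2) by (metis id_comp o_assoc)
  have "galg_mult n (galg_basis u) g s
      = (\<Sum>u'\<in>sym_grp n. if u' = u then \<Sum>v\<in>sym_grp n. if u \<circ> v = s then g v else 0 else 0)"
    unfolding galg_mult_def galg_basis_def
  proof (intro sum.cong refl)
    fix u' show "(\<Sum>v\<in>sym_grp n. if u' \<circ> v = s then (if u' = u then 1 else 0) * g v else 0)
        = (if u' = u then \<Sum>v\<in>sym_grp n. if u \<circ> v = s then g v else 0 else 0)"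
      by (cases "u' = u") (auto intro!: sum.neutral cong: if_cong)
  qed
  also have "\<dots> = (\<Sum>v\<in>sym_grp n. if v = u \<circ> s then g v else 0)"
    using u(1) finite_sym_grp by (simp add: sum.delta iff)
  also have "\<dots> = g (u \<circ> s)"
    using comp_in_sym_grp[OF u(1) s] finite_sym_grp by (simp add: sum.delta)
  finally show ?thesis .
qed

definition word_count :: "'a set \<Rightarrow> ('a \<Rightarrow> 'a) \<Rightarrow> nat \<Rightarrow> nat" where
  "word_count V s m = (\<Sum>l\<in>words (V \<times> V) m. of_bool (transposition_prod l = s))"

lemma word_count_Suc:
  "word_count V s (Suc m) = (\<Sum>(i, j)\<in>V \<times> V. word_count V (Transposition.transpose i j \<circ> s) m)"
proof -
  have iff: "Transposition.transpose i j \<circ> q = s \<longleftrightarrow> q = Transposition.transpose i j \<circ> s" for i j q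
    using transpose_comp_transpose_comp by metis
  have "word_count V s (Suc m)
      = (\<Sum>l\<in>words (V \<times> V) m. \<Sum>e\<in>V \<times> V. of_bool (transposition_prod l = Transposition.transpose (fst e) (snd e) \<circ> s))"
    unfolding word_count_def sum_words_Suc
    by (intro sum.cong refl) (clarsimp simp only: transposition_prod.simps iff fst_conv snd_conv)
  also have "\<dots> = (\<Sum>e\<in>V \<times> V. word_count V (Transposition.transpose (fst e) (snd e) \<circ> s) m)"
    unfolding word_count_def by (rule sum.swap)
  finally show ?thesis by (simp add: case_prod_unfold)
qed

text \<open>Let T be the sum of \<open>transpose i j\<close> over all ordered pairs. Then
  \<open>f\<close> is t/2 times T - n^2 id; the identity commutes with T, so the power expands
  binomially, and the coefficient of \<open>s\<close> in T^j is \<open>word_count V s j\<close>.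
  Left multiplication by \<open>f\<close> prepends a letter, and \<open>binomial_shift\<close> plays
  the part of the binomial theorem.\<close>

lemma galg_power_generator:
  fixes n :: nat and t :: real
  defines "V \<equiv> {1..n}" and "f \<equiv> \<lambda>s. complex_of_real t * interchange_generator n s"
  assumes "s \<in> sym_grp n"
  shows "galg_power n f k s = (\<Sum>j\<le>k. of_nat (k choose j)
    * (of_real (t / 2) ^ j * of_nat (word_count V s j)) * (- of_real (t / 2) * (of_nat n)\<^sup>2) ^ (k - j))"
  using assms(3)
proof (induction k arbitrary: s)
  case 0
  then show ?case by (auto simp: galg_power_def galg_basis_def word_count_def words_0)
next
  case (Suc k)
  let ?t = "complex_of_real (t / 2)"
  let ?b = "- ?t * (of_nat n)\<^sup>2"
  let ?a = "\<lambda>s j. ?t ^ j * of_nat (word_count V s j)"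
  let ?g = "galg_power n f k"
  have f: "f = (\<lambda>s. (\<Sum>e\<in>V \<times> V. ?t * galg_basis (Transposition.transpose (fst e) (snd e)) s)
      - (?t * (of_nat n)\<^sup>2) * galg_basis id s)"
  proof
    fix s
    have "f s = ?t * (2 * interchange_generator n s)" by (simp add: f_def)
    also have "\<dots> = (\<Sum>e\<in>V \<times> V. ?t * galg_basis (Transposition.transpose (fst e) (snd e)) s)
      - (?t * (of_nat n)\<^sup>2) * galg_basis id s"
      unfolding interchange_generator_eq V_def[symmetric]
      by (simp only: right_diff_distrib sum_distrib_left case_prod_unfold mult.assoc)
    finally show "f s = (\<Sum>e\<in>V \<times> V. ?t * galg_basis (Transposition.transpose (fst e) (snd e)) s)
      - (?t * (of_nat n)\<^sup>2) * galg_basis id s" .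
  qed
  have tr: "Transposition.transpose (fst e) (snd e) \<in> sym_grp n" if "e \<in> V \<times> V" for e
    using that by (intro transpose_in_sym_grp) (auto simp: V_def)
  have step: "galg_mult n f g s
      = (\<Sum>e\<in>V \<times> V. ?t * g (Transposition.transpose (fst e) (snd e) \<circ> s)) + ?b * g s" for g
  proof -
    have mult: "galg_mult n (galg_basis (Transposition.transpose (fst e) (snd e))) g s
        = g (Transposition.transpose (fst e) (snd e) \<circ> s)" if "e \<in> V \<times> V" for e
      by (rule galg_mult_basis_left[OF tr[OF that] _ Suc.prems]) simp
    have "galg_mult n (galg_basis id) g s = g s"
      using galg_mult_basis_left[OF id_in_sym_grp _ Suc.prems, of g] by simp
    moreover have "galg_mult n f g s
        = (\<Sum>e\<in>V \<times> V. ?t * galg_mult n (galg_basis (Transposition.transpose (fst e) (snd e))) g s)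
          - (?t * (of_nat n)\<^sup>2) * galg_mult n (galg_basis id) g s"
      by (subst f) (simp only: galg_mult_diff_left galg_mult_sum_left galg_mult_cmult_left)
    ultimately show ?thesis by (simp add: mult cong: sum.cong)
  qed
  have "galg_power n f (Suc k) s = galg_mult n f ?g s" by (simp add: galg_power_def)
  also have "\<dots> = (\<Sum>e\<in>V \<times> V. ?t * ?g (Transposition.transpose (fst e) (snd e) \<circ> s)) + ?b * ?g s"
    by (rule step)
  also have "(\<Sum>e\<in>V \<times> V. ?t * ?g (Transposition.transpose (fst e) (snd e) \<circ> s))
      = (\<Sum>e\<in>V \<times> V. \<Sum>j\<le>k. of_nat (k choose j)
          * (?t * ?a (Transposition.transpose (fst e) (snd e) \<circ> s) j) * ?b ^ (k - j))"
    by (intro sum.cong refl, subst Suc.IH[OF comp_in_sym_grp[OF tr Suc.prems]])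
      (simp_all only: sum_distrib_left mult_ac)
  also have "\<dots> = (\<Sum>j\<le>k. of_nat (k choose j)
      * (\<Sum>e\<in>V \<times> V. ?t * ?a (Transposition.transpose (fst e) (snd e) \<circ> s) j) * ?b ^ (k - j))"
    by (subst sum.swap) (simp only: sum_distrib_left sum_distrib_right)
  also have "\<dots> = (\<Sum>j\<le>k. of_nat (k choose j) * ?a s (Suc j) * ?b ^ (k - j))"
    by (simp add: word_count_Suc case_prod_unfold sum_distrib_left mult_ac)
  also have "?b * ?g s = ?b * (\<Sum>j\<le>k. of_nat (k choose j) * ?a s j * ?b ^ (k - j))"
    by (subst Suc.IH[OF Suc.prems]) simp
  also have "(\<Sum>j\<le>k. of_nat (k choose j) * ?a s (Suc j) * ?b ^ (k - j))
      + ?b * (\<Sum>j\<le>k. of_nat (k choose j) * ?a s j * ?b ^ (k - j))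
    = (\<Sum>j\<le>Suc k. of_nat (Suc k choose j) * ?a s j * ?b ^ (Suc k - j))"
    by (rule binomial_shift)
  finally show ?case .
qed

text \<open>The scalar part of the generator yields the factor exp(-t n^2 / 2), exactly the
  normalisation of a Poissonian word at rate t/2 per ordered pair.\<close>

lemma interchange_semigroup_eq:
  assumes s: "s \<in> sym_grp n"
  shows "interchange_semigroup n t s
    = of_real (word_mean {1..n} (t / 2) (\<lambda>l. of_bool (transposition_prod l = s)))"
proof -
  let ?V = "{1..n}"
  let ?F = "\<lambda>l. of_bool (transposition_prod l = s) :: real"
  let ?r = "\<lambda>j. (t / 2) ^ j * (\<Sum>l\<in>words (?V \<times> ?V) j. ?F l)"
  let ?a = "\<lambda>j. of_real (t / 2) ^ j * of_nat (word_count ?V s j) :: complex"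
  have "?r j = (t / 2) ^ j * real (word_count ?V s j)" for j by (simp add: word_count_def)
  then have wc: "?a j = of_real (?r j)" for j
    by (simp only: of_real_mult of_real_power of_real_of_nat_eq)
  have sm: "summable (\<lambda>j. norm (?r j / fact j))"
    by (rule summable_norm_word_sum[where C = 1]) auto
  then have smc: "summable (\<lambda>j. norm (?a j / fact j))"
  proof -
    have "norm (of_real x / fact j :: complex) = norm (x / fact j)" for x :: real and j
      by (simp add: norm_divide)
    then show ?thesis unfolding wc using sm by (simp only:)
  qed
  have "interchange_semigroup n t s
      = (\<Sum>k. (\<Sum>j\<le>k. of_nat (k choose j) * ?a j * (- of_real (t / 2) * (of_nat n)\<^sup>2) ^ (k - j)) / fact k)"
    unfolding interchange_semigroup_def galg_exp_def galg_power_generator[OF s] ..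
  also have "\<dots> = (\<Sum>j. ?a j / fact j) * exp (- of_real (t / 2) * (of_nat n)\<^sup>2)"
    by (rule suminf_binomial_exp[OF smc])
  also have "(\<Sum>j. ?a j / fact j) = of_real (\<Sum>j. ?r j / fact j)"
    unfolding wc using suminf_of_real[OF summable_norm_cancel[OF sm], where 'a = complex] by simp
  also have "exp (- of_real (t / 2) * (of_nat n)\<^sup>2) = complex_of_real (exp (- (t / 2 * (real n)\<^sup>2)))"
    by (simp flip: exp_of_real)
  finally show ?thesis by (simp add: word_mean_def word_sum_def)
qed

section \<open>The law of the process at a fixed time\<close>

context interchange_process
begin

lemma prob_eq_word_mean:
  assumes "0 \<le> t" "s \<in> sym_grp n"
  shows "prob {\<omega> \<in> space M. \<sigma> t \<omega> = s}
    = word_mean {1..n} (t / 2) (\<lambda>l. of_bool (transposition_prod l = s))"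
proof -
  \<comment> \<open>The one-time law is the finite-dimensional distribution with a single increment,
    from \<open>id\<close> at time 0 to \<open>s\<close> at time \<open>t\<close>.\<close>
  let ?t = "\<lambda>i :: nat. if i = 0 then 0 else t" and ?s = "\<lambda>i :: nat. if i = 0 then id else s"
  have "complex_of_real (prob {\<omega> \<in> space M. \<forall>i\<in>{1..1}. \<sigma> (?t i) \<omega> = ?s i})
      = (\<Prod>i<1. interchange_semigroup n (?t (Suc i) - ?t i) (inv (?s i) \<circ> ?s (Suc i)))"
    using assms id_in_sym_grp by (intro finite_dim_distr) auto
  then have "complex_of_real (prob {\<omega> \<in> space M. \<sigma> t \<omega> = s}) = interchange_semigroup n t s"
    by (simp add: inv_id)
  then show ?thesis unfolding interchange_semigroup_eq[OF assms(2)] of_real_eq_iff .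
qed

lemma expectation_eq_word_mean:
  assumes t: "0 \<le> t"
  shows "expectation (\<lambda>\<omega>. f (\<sigma> t \<omega>)) = word_mean {1..n} (t / 2) (\<lambda>l. f (transposition_prod l))"
proof -
  let ?G = "sym_grp n"
  let ?X = "\<lambda>s. {\<omega> \<in> space M. \<sigma> t \<omega> = s}"
  have meas: "?X s \<in> sets M" if "s \<in> ?G" for s
    using measurable_sets[OF random_variable[OF t], of "{s}"] that
    by (simp add: vimage_def Int_def conj_commute)
  have int: "integrable M (indicator (?X s) :: _ \<Rightarrow> real)" if "s \<in> ?G" for s
    using meas[OF that] by (intro integrable_real_indicator) (simp_all add: emeasure_eq_measure)
  have G: "\<sigma> t \<omega> \<in> ?G" if "\<omega> \<in> space M" for \<omega>
    using measurable_space[OF random_variable[OF t] that] by simp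
  have "expectation (\<lambda>\<omega>. f (\<sigma> t \<omega>)) = expectation (\<lambda>\<omega>. \<Sum>s\<in>?G. f s * indicator (?X s) \<omega>)"
  proof (rule Bochner_Integration.integral_cong[OF refl])
    fix \<omega> assume \<omega>: "\<omega> \<in> space M"
    then have "(\<Sum>s\<in>?G. f s * indicator (?X s) \<omega>) = (\<Sum>s\<in>?G. if s = \<sigma> t \<omega> then f s else 0)"
      by (intro sum.cong) auto
    then show "f (\<sigma> t \<omega>) = (\<Sum>s\<in>?G. f s * indicator (?X s) \<omega>)"
      using G[OF \<omega>] finite_sym_grp by simp
  qed
  also have "\<dots> = (\<Sum>s\<in>?G. expectation (\<lambda>\<omega>. f s * indicator (?X s) \<omega>))"
    using int by (intro Bochner_Integration.integral_sum integrable_mult_right)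
  also have "\<dots> = (\<Sum>s\<in>?G. f s * prob (?X s))"
    by (intro sum.cong refl) (simp add: Int_def conj_commute cong: conj_cong)
  also have "\<dots> = (\<Sum>s\<in>?G. word_mean {1..n} (t / 2) (\<lambda>l. f s * of_bool (transposition_prod l = s)))"
    using prob_eq_word_mean[OF t] by (intro sum.cong refl) (subst word_mean_cmult[where C = 1], auto)
  also have "\<dots> = word_mean {1..n} (t / 2) (\<lambda>l. \<Sum>s\<in>?G. f s * of_bool (transposition_prod l = s))"
    using finite_sym_grp
    by (intro word_mean_sum[symmetric, where C = "\<lambda>s. \<bar>f s\<bar>"]) (auto simp: of_bool_def)
  also have "\<dots> = word_mean {1..n} (t / 2) (\<lambda>l. f (transposition_prod l))"
  proof (rule word_mean_cong)
    fix l :: "(nat \<times> nat) list" assume "set l \<subseteq> {1..n} \<times> {1..n}"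
    then have "transposition_prod l \<in> ?G"
      using transposition_prod_permutes by (auto simp: sym_grp_def)
    moreover have "f s * of_bool (transposition_prod l = s)
        = (if transposition_prod l = s then f s else 0)" for s by simp
    ultimately show "(\<Sum>s\<in>?G. f s * of_bool (transposition_prod l = s)) = f (transposition_prod l)"
      using finite_sym_grp by (simp only: sum.delta' if_True)
  qed
  finally show ?thesis .
qed

lemma expectation_transposition_length:
  assumes t: "0 \<le> t"
  shows "expectation (\<lambda>\<omega>. real (transposition_length n (\<sigma> t \<omega>)))
    = real n - word_mean {1..n} (t / 2) (\<lambda>l. real (card (orbit (transposition_prod l) ` {1..n})))"
proof -
  let ?N = "\<lambda>l. real (card (orbit (transposition_prod l) ` {1..n}))"
  have le: "card (orbit p ` {1..n}) \<le> n" for p :: "nat \<Rightarrow> nat"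
    using card_image_le[of "{1..n}" "orbit p"] by simp
  have "expectation (\<lambda>\<omega>. real (transposition_length n (\<sigma> t \<omega>)))
      = word_mean {1..n} (t / 2) (\<lambda>l. real (transposition_length n (transposition_prod l)))"
    by (rule expectation_eq_word_mean[OF t])
  also have "\<dots> = word_mean {1..n} (t / 2) (\<lambda>l. real n + - 1 * ?N l)"
  proof (rule word_mean_cong)
    fix l :: "(nat \<times> nat) list" assume "set l \<subseteq> {1..n} \<times> {1..n}"
    then have "transposition_prod l \<in> sym_grp n"
      using transposition_prod_permutes by (auto simp: sym_grp_def)
    then show "real (transposition_length n (transposition_prod l)) = real n + - 1 * ?N l"
      using le by (simp add: transposition_length_eq of_nat_diff)
  qed
  also have "\<dots> = word_mean {1..n} (t / 2) (\<lambda>l. real n) + word_mean {1..n} (t / 2) (\<lambda>l. - 1 * ?N l)"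
    using le by (intro word_mean_add[where C = "real n"]) auto
  also have "word_mean {1..n} (t / 2) (\<lambda>l. - 1 * ?N l) = - 1 * word_mean {1..n} (t / 2) ?N"
    using le by (intro word_mean_cmult[where C = "real n"]) auto
  finally show ?thesis by (simp add: word_mean_const)
qed

end

theorem theorem4:
  fixes c :: real
    and M :: "nat \<Rightarrow> 'a measure"
    and \<sigma> :: "nat \<Rightarrow> real \<Rightarrow> 'a \<Rightarrow> (nat \<Rightarrow> nat)"
  assumes "c > 0"
    and "\<And>n. n \<ge> 1 \<Longrightarrow> interchange_process (M n) n (\<sigma> n)"
  shows "(\<lambda>n. 1 / real n *
            prob_space.expectation (M n)
              (\<lambda>\<omega>. real (transposition_length n (\<sigma> n (c / real n) \<omega>))))
         \<longlonglongrightarrow> distance_limit c"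
proof -
  let ?N = "\<lambda>n. word_mean {1..n} (c / (2 * real n))
    (\<lambda>l. real (card (orbit (transposition_prod l) ` {1..n})))"
  \<comment> \<open>The time c/n becomes the rate c/(2n) per ordered pair. Nothing is assumed about
    the process for n = 0, so the two sequences are compared from n = 1 on.\<close>
  have "eventually (\<lambda>n. 1 - ?N n / real n = 1 / real n * prob_space.expectation (M n)
      (\<lambda>\<omega>. real (transposition_length n (\<sigma> n (c / real n) \<omega>)))) sequentially"
    using eventually_ge_at_top[of 1]
  proof eventually_elim
    case (elim n)
    have "0 \<le> c / real n" using assms(1) by simp
    note * = interchange_process.expectation_transposition_length[OF assms(2)[OF elim] this]
    show ?case unfolding * using elim by (simp add: field_simps)
  qed
  moreover have "(\<lambda>n. 1 - ?N n / real n) \<longlonglongrightarrow> distance_limit c"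
    unfolding distance_limit_eq[OF assms(1)]
    by (intro tendsto_intros word_mean_orbits_tendsto(2) assms(1))
  ultimately show ?thesis by (simp add: filterlim_cong)
qed

end
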